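(* Let $a$ and $n$ be even positive integers with $n \geq a(6a+2)$, and let $d \geq 2$ be an integer. Then the $(a,1)$ knight's graph on $[n]^d$ has a Hamiltonian cycle (an $(a,1)$ knight's tour).
   Context: $[n]=\{0,1,\dots,n-1\}$. For positive integers $a,b$, the $(a,b)$ knight's graph on $[n]^d$ has vertex set $[n]^d$, two vertices being adjacent iff they differ in exactly two coordinates, by $a$ in absolute value in one of them and by $b$ in absolute value in the other. An $(a,b)$ knight's tour is a Hamiltonian cycle in this graph. *)

theory Defs
  imports "Graph_Theory.Graph_Theory"
begin

definition grid :: "nat \<Rightarrow> nat \<Rightarrow> nat list set" where
  "grid n d = {x. length x = d \<and> set x \<subseteq> {..<n}}"

definition knight_adj :: "nat \<Rightarrow> nat \<Rightarrow> nat \<Rightarrow> nat list \<Rightarrow> nat list \<Rightarrow> bool" where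
  "knight_adj a b d x y \<longleftrightarrow>
     (\<exists>i j. i \<noteq> j \<and> {k. k < d \<and> x ! k \<noteq> y ! k} = {i, j} \<and>
        \<bar>int (x ! i) - int (y ! i)\<bar> = int a \<and> \<bar>int (x ! j) - int (y ! j)\<bar> = int b)"

text \<open>An undirected graph is a symmetric loop-free digraph, each edge being a pair of
  opposite arcs.\<close>

definition knight_graph :: "nat \<Rightarrow> nat \<Rightarrow> nat \<Rightarrow> nat \<Rightarrow> nat list pair_pre_digraph" where
  "knight_graph a b n d =
     \<lparr> pverts = grid n d,
       parcs = {(x, y). x \<in> grid n d \<and> y \<in> grid n d \<and> knight_adj a b d x y} \<rparr>"

lemma finite_grid: "finite (grid n d)"
proof -
  have "grid n d = {xs. set xs \<subseteq> {..<n} \<and> length xs = d}"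
    by (auto simp: grid_def)
  then show ?thesis
    by (simp add: finite_lists_length_eq)
qed

lemma knight_adj_sym:
  assumes "knight_adj a b d x y"
  shows "knight_adj a b d y x"
proof -
  obtain i j where "i \<noteq> j" and *: "{k. k < d \<and> x ! k \<noteq> y ! k} = {i, j}"
    and "\<bar>int (x ! i) - int (y ! i)\<bar> = int a" "\<bar>int (x ! j) - int (y ! j)\<bar> = int b"
    using assms unfolding knight_adj_def by blast
  moreover have "{k. k < d \<and> y ! k \<noteq> x ! k} = {i, j}"
    unfolding *[symmetric] by (rule Collect_cong) (rule conj_cong[OF refl], rule neq_commute)
  ultimately show ?thesis
    unfolding knight_adj_def by (intro exI[of _ i] exI[of _ j]) (simp add: abs_minus_commute)
qed

lemma knight_adj_irrefl: "\<not> knight_adj a b d x x"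
  unfolding knight_adj_def by simp

lemma pair_graph_knight_graph: "pair_graph (knight_graph a b n d)"
proof
  show "finite (parcs (knight_graph a b n d))"
    by (rule finite_subset[of _ "grid n d \<times> grid n d"])
      (auto simp: knight_graph_def finite_grid)
  show "symmetric (with_proj (knight_graph a b n d))"
    unfolding symmetric_def arcs_ends_conv
    by (rule symI) (auto simp: knight_graph_def knight_adj_sym)
qed (auto simp: knight_graph_def finite_grid knight_adj_irrefl)

text \<open>The length bound excludes the closed walk that traverses one edge back and forth,
  which the digraph notion of cycle admits.\<close>

definition (in pre_digraph) hamiltonian_cycle :: "'b awalk \<Rightarrow> bool" where
  "hamiltonian_cycle p \<longleftrightarrow> cycle p \<and> 3 \<le> length p \<and> tail G ` set p = verts G"

end

theory Submission
  imports Defs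
begin

text \<open>
  A spanning 2-regular subgraph becomes a Hamiltonian cycle by switching: if \<open>u v\<close> and \<open>u' v'\<close> are
  edges in different components and \<open>u u'\<close>, \<open>v v'\<close> are edges of the ambient graph, exchanging the
  former pair for the latter merges the two components. A family of switches with pairwise disjoint
  edges that connects all components can be carried out one after the other.

  If the tour of \<open>[n]\<^sup>d\<close> contains an edge together with its translate by \<open>a\<close> along an axis, the
  copies of the tour in consecutive layers of dimension \<open>d + 1\<close> can be merged by such switches, and every
  unswitched edge provides a translated pair along the new axis. This leaves \<open>d = 2\<close>.

  In the plane, pair \<open>2s\<close> with \<open>2s + 1\<close> in both coordinates. With moves respecting the pairs, the board
  falls apart into copies of ordinary rectangular grids, indexed by \<open>x div a\<close> and \<open>y div a\<close>. Strips of
  two adjacent columns of such a grid carry an obvious cycle. When the number of columns is odd, one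
  strip of three columns is needed as well; it is cut into blocks of height \<open>2 * a\<close>, each a union of
  \<open>3 \<times> 2\<close> grid cycles, and blocks of height \<open>2 * a + 2\<close>, where a chain of moves across the pairs repairs
  the imbalance of the \<open>3 \<times> 3\<close> grid. Switches across the pairs finally merge everything.
\<close>

section \<open>Switching in 2-regular graphs\<close>

definition two_regular :: "'v set \<Rightarrow> 'v rel \<Rightarrow> bool" where
  "two_regular V F \<longleftrightarrow>
     finite V \<and> F \<subseteq> V \<times> V \<and> sym F \<and> irrefl F \<and> (\<forall>v\<in>V. card (F `` {v}) = 2)"

definition edge :: "'v \<Rightarrow> 'v \<Rightarrow> 'v rel" where
  "edge u v = {(u, v), (v, u)}"

text \<open>Handshaking: without loops the arcs split into pairs of opposite ones, and the induction
  removes one pair at a time.\<close>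

lemma even_card_sym_irrefl:
  assumes "finite F" "sym F" "irrefl F"
  shows "even (card F)"
  using assms
proof (induction "card F" arbitrary: F rule: less_induct)
  case less
  show ?case
  proof (cases "F = {}")
    case False
    then obtain u v where uv: "(u, v) \<in> F" by auto
    with less.prems have vu: "(v, u) \<in> F" "u \<noteq> v"
      by (auto dest: symD simp: irrefl_def)
    have sub: "edge u v \<subseteq> F" and c2: "card (edge u v) = 2"
      using uv vu by (auto simp: edge_def)
    let ?F = "F - edge u v"
    have "card ?F = card F - 2" "card F \<ge> 2"
      using less.prems sub c2 card_mono[OF less.prems(1) sub]
      by (simp_all add: card_Diff_subset finite_subset)
    moreover have "sym ?F" "irrefl ?F"
      using less.prems by (auto simp: sym_def irrefl_def edge_def)
    ultimately show ?thesis
      using less.hyps[of ?F] less.prems by auto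
  qed simp
qed

text \<open>An edge is never a bridge: deleting it would leave a component whose degree sum is odd.\<close>

lemma two_regular_edge_on_cycle:
  assumes F: "two_regular V F" and uv: "(u, v) \<in> F"
  shows "(u, v) \<in> (F - edge u v)\<^sup>*"
proof (rule ccontr)
  let ?F = "F - edge u v"
  define C where "C = ?F\<^sup>* `` {u}"
  assume "(u, v) \<notin> ?F\<^sup>*"
  then have v: "v \<notin> C" by (simp add: C_def)
  have u: "u \<in> C" by (simp add: C_def)
  have CV: "C \<subseteq> V"
  proof
    fix w assume "w \<in> C"
    then have "(u, w) \<in> ?F\<^sup>*" by (simp add: C_def)
    then show "w \<in> V"
      using F uv by (induction rule: rtrancl_induct) (auto simp: two_regular_def)
  qed
  with F have fC: "finite C" by (auto simp: two_regular_def finite_subset)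
  have symF: "sym ?F" "irrefl ?F"
    using F by (auto simp: two_regular_def sym_def irrefl_def edge_def)
  define G where "G = Sigma C (\<lambda>w. ?F `` {w})"
  have closed: "z \<in> C" if "w \<in> C" "(w, z) \<in> ?F" for w z
    using that by (auto simp: C_def intro: rtrancl_into_rtrancl)
  have fin: "finite (?F `` {w})" for w
    by (rule finite_subset[of _ V]) (use F in \<open>auto simp: two_regular_def\<close>)
  have "sym G"
  proof (rule symI)
    fix w z assume "(w, z) \<in> G"
    then have "w \<in> C" "(w, z) \<in> ?F" by (simp_all add: G_def)
    moreover from this have "z \<in> C" "(z, w) \<in> ?F" using closed symF(1) by (blast, metis symD)
    ultimately show "(z, w) \<in> G" by (simp add: G_def)
  qed
  moreover have "irrefl G" using symF(2) by (auto simp: G_def irrefl_def)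
  moreover have "finite G" unfolding G_def using fC fin by auto
  ultimately have ev: "even (card G)" by (rule even_card_sym_irrefl[rotated])
  \<comment> \<open>Inside \<open>C\<close> only \<open>u\<close> has lost a neighbour, as
    \<open>v\<close> lies outside; this makes the degree sum odd.\<close>
  have deg: "card (?F `` {w}) = 2" if "w \<in> C - {u}" for w
  proof -
    have "?F `` {w} = F `` {w}" using that v by (auto simp: edge_def)
    with that CV F show ?thesis by (auto simp: two_regular_def)
  qed
  have "u \<noteq> v" using u v by auto
  then have "?F `` {u} = F `` {u} - {v}" by (auto simp: edge_def)
  moreover have "card (F `` {u}) = 2" using F u CV by (auto simp: two_regular_def)
  ultimately have degu: "card (?F `` {u}) = 1" using uv by simp
  have "card G = (\<Sum>w\<in>C. card (?F `` {w}))"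
    unfolding G_def using fC fin by (intro card_SigmaI) auto
  also have "\<dots> = 1 + (\<Sum>w\<in>C - {u}. card (?F `` {w}))"
    using u fC degu by (simp add: sum.remove)
  also have "\<dots> = 1 + 2 * card (C - {u})" using deg by simp
  finally show False using ev by simp
qed

definition switched :: "'v rel \<Rightarrow> 'v \<Rightarrow> 'v \<Rightarrow> 'v \<Rightarrow> 'v \<Rightarrow> 'v rel" where
  "switched F u v u' v' = F - (edge u v \<union> edge u' v') \<union> (edge u u' \<union> edge v v')"

text \<open>Each of the four ends trades one neighbour for a vertex of the other component, so the
  degrees stay 2. As no edge is a bridge, the ends of a deleted edge remain joined inside their own
  component, which does not contain the other deleted edge.\<close>

lemma switched_two_regular:
  assumes F: "two_regular V F" and e: "(u, v) \<in> F" "(u', v') \<in> F"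
    and sep: "(u, u') \<notin> F\<^sup>*"
  shows "two_regular V (switched F u v u' v')"
    and "F\<^sup>* \<subseteq> (switched F u v u' v')\<^sup>*"
proof -
  let ?F = "switched F u v u' v'"
  have symF: "sym F" and irr: "irrefl F" using F by (auto simp: two_regular_def)
  then have symFs: "(y, x) \<in> F\<^sup>*" if "(x, y) \<in> F\<^sup>*" for x y
    using that by (meson sym_rtrancl symD)
  have sep4: "(x, y) \<notin> F\<^sup>*" if "x \<in> {u, v}" "y \<in> {u', v'}" for x y
  proof
    assume "(x, y) \<in> F\<^sup>*"
    moreover have "(u, x) \<in> F\<^sup>*" using that e by auto
    moreover have "(y, u') \<in> F\<^sup>*" using that e symFs by auto
    ultimately show False using sep by (meson rtrancl_trans)
  qed
  then have sep1: "(x, y) \<notin> F" "(y, x) \<notin> F" "x \<noteq> y" if "x \<in> {u, v}" "y \<in> {u', v'}" for x y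
    using that symF by (auto dest: symD)
  have dist: "u \<noteq> v" "u' \<noteq> v'" "u \<noteq> u'" "u \<noteq> v'" "v \<noteq> u'" "v \<noteq> v'"
    using sep1[of u u'] sep1[of u v'] sep1[of v u'] sep1[of v v'] e irr by (auto simp: irrefl_def)
  have inV: "u \<in> V" "v \<in> V" "u' \<in> V" "v' \<in> V" using F e by (auto simp: two_regular_def)
  have finN: "finite (F `` {w})" for w
    by (rule finite_subset[of _ V]) (use F in \<open>auto simp: two_regular_def\<close>)
  have swap: "card (?F `` {w}) = 2" if w: "w \<in> V" for w
  proof -
    have c: "card (F `` {w}) = 2" using F w by (auto simp: two_regular_def)
    have exch: "card (insert q (F `` {w} - {p})) = 2" if "p \<in> F `` {w}" "q \<notin> F `` {w}" for p q
      using that c finN[of w] by simp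
    have e': "(v, u) \<in> F" "(v', u') \<in> F" using e symF by (auto dest: symD)
    consider "w = u" | "w = v" | "w = u'" | "w = v'" | "w \<notin> {u, v, u', v'}" by auto
    then show ?thesis
    proof cases
      case 1
      then have "?F `` {w} = insert u' (F `` {w} - {v})"
        using dist by (auto simp: switched_def edge_def)
      then show ?thesis using exch[of v u'] e sep1[of u u'] 1 by auto
    next
      case 2
      then have "?F `` {w} = insert v' (F `` {w} - {u})"
        using dist by (auto simp: switched_def edge_def)
      then show ?thesis using exch[of u v'] e' sep1[of v v'] 2 by auto
    next
      case 3
      then have "?F `` {w} = insert u (F `` {w} - {v'})"
        using dist by (auto simp: switched_def edge_def)
      then show ?thesis using exch[of v' u] e sep1[of u u'] 3 by auto
    next
      case 4
      then have "?F `` {w} = insert v (F `` {w} - {u'})"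
        using dist by (auto simp: switched_def edge_def)
      then show ?thesis using exch[of u' v] e' sep1[of v v'] 4 by auto
    next
      case 5
      then have "?F `` {w} = F `` {w}" by (auto simp: switched_def edge_def)
      then show ?thesis using c by simp
    qed
  qed
  have "?F \<subseteq> V \<times> V" "irrefl ?F" "sym ?F"
    using F inV dist by (auto simp: two_regular_def switched_def edge_def irrefl_def sym_def)
  with F swap show "two_regular V ?F" by (auto simp: two_regular_def)
  have symF': "sym (?F\<^sup>*)" by (rule sym_rtrancl) fact
  have path: "(x, y) \<in> ?F\<^sup>*"
    if xy: "(x, y) \<in> F" and xe: "edge x y \<in> {edge u v, edge u' v'}" for x y
  proof -
    have "(x, z) \<in> ?F\<^sup>*" if "(x, z) \<in> (F - edge x y)\<^sup>*" for z
      using that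
    proof (induction rule: rtrancl_induct)
      case (step w z)
      have "(x, w) \<in> F\<^sup>*" using step.hyps(1) by (rule rtrancl_mono[THEN subsetD, rotated]) auto
      then have x: "(x, w) \<in> F\<^sup>*" "(x, z) \<in> F\<^sup>*" using step.hyps(2) by auto
      have "(w, z) \<in> ?F"
      proof (cases "(w, z) \<in> edge u v \<union> edge u' v'")
        case True
        have "x \<in> {u, v} \<and> w \<in> {u', v'} \<or> w \<in> {u, v} \<and> x \<in> {u', v'}"
          using True step.hyps(2) xe by (auto simp: edge_def doubleton_eq_iff)
        then show ?thesis using sep4 x(1) symFs by blast
      qed (use step.hyps(2) in \<open>auto simp: switched_def\<close>)
      with step.IH show ?case by auto
    qed simp
    then show ?thesis using two_regular_edge_on_cycle[OF F xy] by blast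
  qed
  have "F \<subseteq> ?F\<^sup>*"
  proof (rule subrelI)
    fix x y assume xy: "(x, y) \<in> F"
    show "(x, y) \<in> ?F\<^sup>*"
    proof (cases "(x, y) \<in> edge u v \<union> edge u' v'")
      case True
      then have "edge x y \<in> {edge u v, edge u' v'}" by (auto simp: edge_def)
      then show ?thesis by (rule path[OF xy])
    next
      case False
      then show ?thesis using xy by (auto simp: switched_def)
    qed
  qed
  then show "F\<^sup>* \<subseteq> ?F\<^sup>*" by (metis rtrancl_mono rtrancl_idemp)
qed

type_synonym 'v switch = "'v \<times> 'v \<times> 'v \<times> 'v"

fun switch_edges :: "'v switch \<Rightarrow> 'v rel" where
  "switch_edges (u, v, u', v') = edge u v \<union> edge u' v'"

text \<open>A switch whose first ends are already connected is skipped, so the conclusion promises a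
  path from \<open>u\<close> to \<open>u'\<close> and not the new edge. Disjointness keeps the edges
  of the remaining switches in place during the induction.\<close>

lemma switching:
  assumes "finite S" and "two_regular V F" and "F \<subseteq> E" and "sym E"
    and "\<And>u v u' v'. (u, v, u', v') \<in> S \<Longrightarrow>
      (u, v) \<in> F \<and> (u', v') \<in> F \<and> (u, u') \<in> E \<and> (v, v') \<in> E"
    and "\<And>s s'. s \<in> S \<Longrightarrow> s' \<in> S \<Longrightarrow> s \<noteq> s' \<Longrightarrow> switch_edges s \<inter> switch_edges s' = {}"
  shows "\<exists>F'. two_regular V F' \<and> F' \<subseteq> E \<and> F \<subseteq> F'\<^sup>* \<and> F - \<Union>(switch_edges ` S) \<subseteq> F' \<and>
    (\<forall>(u, v, u', v')\<in>S. (u, u') \<in> F'\<^sup>*)"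
  using assms
proof (induction S arbitrary: F rule: finite_induct)
  case empty
  then show ?case by (intro exI[of _ F]) auto
next
  case (insert s S)
  obtain u v u' v' where s: "s = (u, v, u', v')" by (cases s)
  have sF: "(u, v) \<in> F" "(u', v') \<in> F" "(u, u') \<in> E" "(v, v') \<in> E"
    using insert.prems(4)[of u v u' v'] s by auto
  have "\<exists>F1. two_regular V F1 \<and> F1 \<subseteq> E \<and> F\<^sup>* \<subseteq> F1\<^sup>* \<and> F - switch_edges s \<subseteq> F1 \<and> (u, u') \<in> F1\<^sup>*"
  proof (cases "(u, u') \<in> F\<^sup>*")
    case True
    with insert.prems show ?thesis by (intro exI[of _ F]) auto
  next
    case False
    let ?F = "switched F u v u' v'"
    have "?F \<subseteq> E"
      using insert.prems(2,3) sF by (auto simp: switched_def edge_def dest: symD)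
    moreover have "F - switch_edges s \<subseteq> ?F" by (auto simp: s switched_def)
    moreover have "(u, u') \<in> ?F\<^sup>*" by (auto simp: switched_def edge_def)
    ultimately show ?thesis
      using switched_two_regular[OF insert.prems(1) sF(1,2) False] by blast
  qed
  then obtain F1 where F1: "two_regular V F1" "F1 \<subseteq> E" "F\<^sup>* \<subseteq> F1\<^sup>*"
      "F - switch_edges s \<subseteq> F1" "(u, u') \<in> F1\<^sup>*"
    by blast
  have "\<exists>F'. two_regular V F' \<and> F' \<subseteq> E \<and> F1 \<subseteq> F'\<^sup>* \<and> F1 - \<Union>(switch_edges ` S) \<subseteq> F' \<and>
    (\<forall>(u, v, u', v')\<in>S. (u, u') \<in> F'\<^sup>*)"
  proof (rule insert.IH[OF F1(1,2) insert.prems(3)])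
    fix x y x' y' assume xy: "(x, y, x', y') \<in> S"
    then have "switch_edges (x, y, x', y') \<inter> switch_edges s = {}"
      using insert.prems(5)[of "(x, y, x', y')" s] insert.hyps(2) by auto
    then have "(x, y) \<notin> switch_edges s" "(x', y') \<notin> switch_edges s"
      by (auto simp: edge_def)
    with xy insert.prems(4)[of x y x' y'] F1(4)
    show "(x, y) \<in> F1 \<and> (x', y') \<in> F1 \<and> (x, x') \<in> E \<and> (y, y') \<in> E" by auto
  qed (use insert.prems(5) in auto)
  then obtain F' where F': "two_regular V F'" "F' \<subseteq> E" "F1 \<subseteq> F'\<^sup>*"
      "F1 - \<Union>(switch_edges ` S) \<subseteq> F'" "\<forall>(u, v, u', v')\<in>S. (u, u') \<in> F'\<^sup>*"
    by blast
  have F1F': "F1\<^sup>* \<subseteq> F'\<^sup>*" using F'(3) by (metis rtrancl_mono rtrancl_idemp)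
  show ?case
    using F' F1 F1F' s by (intro exI[of _ F'] conjI) (auto simp del: switch_edges.simps)
qed

section \<open>Connected 2-regular graphs as cyclic lists\<close>

definition connected_two_factor :: "'v set \<Rightarrow> 'v rel \<Rightarrow> bool" where
  "connected_two_factor V F \<longleftrightarrow> two_regular V F \<and> V \<times> V \<subseteq> F\<^sup>*"

text \<open>In a longest path the neighbours of the last vertex lie on the path, and degree 2 leaves
  only its predecessor and the first vertex for them. The closed path then contains both neighbours
  of each of its vertices, so by connectedness it covers \<open>V\<close>.\<close>

lemma connected_two_factor_cyclic_list:
  assumes F: "connected_two_factor V F" and "V \<noteq> {}"
  shows "\<exists>xs. distinct xs \<and> set xs = V \<and> 3 \<le> length xs \<and>
    successively (\<lambda>x y. (x, y) \<in> F) xs \<and> (last xs, hd xs) \<in> F"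
proof -
  have tr: "two_regular V F" and conn: "V \<times> V \<subseteq> F\<^sup>*"
    using F by (auto simp: connected_two_factor_def)
  have fV: "finite V" and symF: "sym F" and FV: "F \<subseteq> V \<times> V" and irr: "irrefl F"
    and deg: "\<And>v. v \<in> V \<Longrightarrow> card (F `` {v}) = 2"
    using tr by (auto simp: two_regular_def)
  define path where "path xs \<longleftrightarrow> xs \<noteq> [] \<and> distinct xs \<and> set xs \<subseteq> V \<and>
    successively (\<lambda>x y. (x, y) \<in> F) xs" for xs
  obtain v0 where "v0 \<in> V" using \<open>V \<noteq> {}\<close> by auto
  then have p0: "path [v0]" by (simp add: path_def)
  have bd: "length xs \<le> card V" if "path xs" for xs
    using that fV by (metis path_def card_mono distinct_card)
  obtain xs where xs: "path xs" and max: "\<And>ys. path ys \<Longrightarrow> length ys \<le> length xs"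
    using ex_has_greatest_nat[of path "[v0]" length "Suc (card V)"] p0 bd
    by (metis less_Suc_eq_le)
  have x: "xs \<noteq> []" "distinct xs" "set xs \<subseteq> V" "successively (\<lambda>x y. (x, y) \<in> F) xs"
    using xs by (auto simp: path_def)
  have step: "(xs ! k, xs ! Suc k) \<in> F" if "Suc k < length xs" for k
    using x(4) that by (auto simp: successively_conv_nth)
  have third: False if "{p, q, r} \<subseteq> F `` {v}" "p \<noteq> q" "p \<noteq> r" "q \<noteq> r" "v \<in> V" for v p q r
  proof -
    have "card {p, q, r} \<le> card (F `` {v})"
      by (rule card_mono[OF _ that(1)]) (rule finite_subset[OF _ fV], use FV in auto)
    with that deg[of v] show False by simp
  qed
  let ?l = "length xs - 1"
  have last: "last xs = xs ! ?l" using x(1) by (simp add: last_conv_nth)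
  have lastV: "last xs \<in> V" using x by auto
  have nb: "w \<in> set xs" if "(last xs, w) \<in> F" for w
  proof (rule ccontr)
    assume "w \<notin> set xs"
    then have "path (xs @ [w])"
      using x that FV by (auto simp: path_def successively_append_iff)
    from max[OF this] show False by simp
  qed
  obtain w1 w2 where w: "F `` {last xs} = {w1, w2}" "w1 \<noteq> w2"
    using deg[OF lastV] by (auto simp: card_2_iff)
  have idx: "\<exists>k < ?l. w = xs ! k" if "w \<in> {w1, w2}" for w
  proof -
    have "(last xs, w) \<in> F" using w that by auto
    then obtain k where "k < length xs" "w = xs ! k" using nb by (metis in_set_conv_nth)
    moreover have "k \<noteq> ?l" using \<open>(last xs, w) \<in> F\<close> \<open>w = xs ! k\<close> last irr by (auto simp: irrefl_def)
    ultimately show ?thesis by (intro exI[of _ k]) auto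
  qed
  obtain k1 k2 where k: "k1 < ?l" "w1 = xs ! k1" "k2 < ?l" "w2 = xs ! k2"
    using idx[of w1] idx[of w2] by auto
  have "k1 \<noteq> k2" using k w by auto
  \<comment> \<open>An inner vertex of the path already has two neighbours on it, so the last vertex
    would be a third unless it is one of these.\<close>
  have low: "k = 0 \<or> Suc k = ?l" if "k < ?l" "(last xs, xs ! k) \<in> F" for k
  proof (rule ccontr)
    assume neg: "\<not> ?thesis"
    then obtain j where j: "k = Suc j" by (cases k) auto
    have "(xs ! k, xs ! j) \<in> F" using step[of j] that(1) j symF by (auto intro: symD)
    moreover have "(xs ! k, xs ! Suc k) \<in> F" using step[of k] that(1) by auto
    moreover have "(xs ! k, xs ! ?l) \<in> F" using that(2) last symF by (auto intro: symD)
    moreover have "xs ! j \<noteq> xs ! Suc k" "xs ! j \<noteq> xs ! ?l" "xs ! Suc k \<noteq> xs ! ?l"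
      using neg j that(1) x(2) by (auto simp: nth_eq_iff_index_eq)
    moreover have "xs ! k \<in> V" using x that(1) by auto
    ultimately show False using third[of "xs ! j" "xs ! Suc k" "xs ! ?l" "xs ! k"] by auto
  qed
  have "(last xs, xs ! k1) \<in> F" "(last xs, xs ! k2) \<in> F" using w k by auto
  with low k \<open>k1 \<noteq> k2\<close> have closing: "(last xs, xs ! 0) \<in> F" and len: "3 \<le> length xs"
    by (metis Suc_inject, (cases "k1 = 0"; fastforce))
  have closed: "w \<in> set xs" if vx: "v \<in> set xs" and "(v, w) \<in> F" for v w
  proof (rule ccontr)
    assume wn: "w \<notin> set xs"
    obtain k where k: "k < length xs" "v = xs ! k" using vx by (metis in_set_conv_nth)
    have vV: "v \<in> V" using vx x by auto
    have k0: "k \<noteq> ?l" using nb[of w] that wn k last by auto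
    have up: "(v, xs ! Suc k) \<in> F" using step[of k] k k0 by auto
    \<comment> \<open>The cyclic predecessor of \<open>k\<close>: the closing edge makes the last
      vertex precede the first. With both path neighbours of \<open>v\<close> known,
      \<open>w\<close> is a third one.\<close>
    define q where "q = (if k = 0 then ?l else k - 1)"
    have q: "q < length xs" "q \<noteq> Suc k" using k k0 len by (auto simp: q_def)
    have dn: "(v, xs ! q) \<in> F"
    proof (cases k)
      case 0
      then show ?thesis using closing last k symF by (auto simp: q_def intro: symD)
    next
      case (Suc j)
      then show ?thesis using step[of j] k symF by (auto simp: q_def intro: symD)
    qed
    have "xs ! Suc k \<noteq> xs ! q" using q k k0 x(2) by (auto simp: nth_eq_iff_index_eq)
    moreover have "w \<noteq> xs ! Suc k" "w \<noteq> xs ! q" using wn q k k0 by auto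
    ultimately show False
      using third[of "xs ! Suc k" "xs ! q" w v] up dn that vV by auto
  qed
  have "V \<subseteq> set xs"
  proof
    fix v assume "v \<in> V"
    moreover have "hd xs \<in> V" using x(1,3) by auto
    ultimately have "(hd xs, v) \<in> F\<^sup>*" using conn by auto
    then show "v \<in> set xs"
      using x(1) by (induction rule: rtrancl_induct) (auto intro: closed)
  qed
  with x closing len show ?thesis by (intro exI[of _ xs]) (auto simp: hd_conv_nth)
qed

section \<open>From dimension \<open>d\<close> to dimension \<open>d + 1\<close>\<close>

lemma cyclic_list_awalk:
  assumes "xs \<noteq> []"
  shows "pcas (hd xs) (zip xs (tl xs @ [w])) w"
    and "pawalk_verts (hd xs) (zip xs (tl xs @ [w])) = xs @ [w]"
    and "map fst (zip xs (tl xs @ [w])) = xs"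
    and "successively (\<lambda>x y. (x, y) \<in> F) xs \<Longrightarrow> (last xs, w) \<in> F \<Longrightarrow>
      set (zip xs (tl xs @ [w])) \<subseteq> F"
  using assms by (induction xs rule: induct_list012) auto

lemma connected_two_factor_hamiltonian:
  assumes F: "connected_two_factor (pverts G) F" and "F \<subseteq> parcs G" and "pverts G \<noteq> {}"
  shows "\<exists>p. pre_digraph.hamiltonian_cycle (with_proj G) p"
proof -
  obtain xs where xs: "distinct xs" "set xs = pverts G" "3 \<le> length xs"
      "successively (\<lambda>x y. (x, y) \<in> F) xs" "(last xs, hd xs) \<in> F"
    using connected_two_factor_cyclic_list[OF F assms(3)] by blast
  then have ne: "xs \<noteq> []" by auto
  define p where "p = zip xs (tl xs @ [hd xs])"
  note p = cyclic_list_awalk[OF ne, where w = "hd xs", folded p_def]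
  have len: "length p = length xs" using p(3) by (metis length_map)
  have "distinct (tl (pawalk_verts (hd xs) p))"
    unfolding p(2) using ne xs(1) by (cases xs) auto
  moreover have "set p \<subseteq> parcs G" using p(4)[OF xs(4,5)] assms(2) by auto
  moreover have "hd xs \<in> pverts G" using hd_in_set[OF ne] xs(2) by simp
  ultimately have "pre_digraph.cycle (with_proj G) p"
    unfolding pre_digraph.cycle_def pre_digraph.awalk_def
    using p(1) ne len
    by (intro exI[of _ "hd xs"]) (auto simp: cas_with_proj_eq awalk_verts_with_proj_eq)
  moreover have "fst ` set p = pverts G" using p(3) xs(2) by (metis set_map)
  ultimately show ?thesis
    using xs(3) len by (auto simp: pre_digraph.hamiltonian_cycle_def)
qed

section \<open>Stacking layers of the grid\<close>

lemma Cons_in_grid: "z # x \<in> grid n (Suc d) \<longleftrightarrow> z < n \<and> x \<in> grid n d"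
  by (auto simp: grid_def)

lemma grid_Suc_cases:
  assumes "w \<in> grid n (Suc d)"
  obtains z x where "w = z # x" "z < n" "x \<in> grid n d"
  using assms by (cases w) (auto simp: grid_def)

lemma differing_positions_Cons:
  "{k. k < Suc d \<and> (z # x) ! k \<noteq> (w # y) ! k} =
     (if z = w then {} else {0}) \<union> Suc ` {k. k < d \<and> x ! k \<noteq> y ! k}"
proof (rule set_eqI)
  fix k
  show "k \<in> {k. k < Suc d \<and> (z # x) ! k \<noteq> (w # y) ! k} \<longleftrightarrow>
      k \<in> (if z = w then {} else {0}) \<union> Suc ` {k. k < d \<and> x ! k \<noteq> y ! k}"
    by (cases k) auto
qed

lemma knight_adj_layer:
  assumes "knight_adj a b d x y"
  shows "knight_adj a b (Suc d) (z # x) (z # y)"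
proof -
  obtain i j where "i \<noteq> j" "{k. k < d \<and> x ! k \<noteq> y ! k} = {i, j}"
    "\<bar>int (x ! i) - int (y ! i)\<bar> = int a" "\<bar>int (x ! j) - int (y ! j)\<bar> = int b"
    using assms unfolding knight_adj_def by blast
  then show ?thesis
    unfolding knight_adj_def differing_positions_Cons
    by - (rule exI[of _ "Suc i"], rule exI[of _ "Suc j"], simp)
qed

text \<open>Changing the layer is the move by 1, the translation in coordinate \<open>i\<close> the
  move by \<open>a\<close>. These are the new edges of the switches between layers.\<close>

lemma knight_adj_next_layer:
  assumes "i < d" "length x = d" "a > 0"
  shows "knight_adj a 1 (Suc d) (z # x) (Suc z # x[i := x ! i + a])"
proof -
  have "{k. k < d \<and> x ! k \<noteq> x[i := x ! i + a] ! k} = {i}"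
    using assms by (auto simp: nth_list_update)
  then show ?thesis
    unfolding knight_adj_def differing_positions_Cons using assms
    by - (rule exI[of _ "Suc i"], rule exI[of _ 0], auto)
qed

text \<open>Two edges of the tour that differ by the translation by \<open>a\<close> along one axis make it
  possible to splice together copies of the tour in consecutive layers of the next dimension.\<close>

definition stackable_tour :: "nat \<Rightarrow> nat \<Rightarrow> nat \<Rightarrow> bool" where
  "stackable_tour a n d \<longleftrightarrow>
     (\<exists>F u v i. connected_two_factor (grid n d) F \<and> F \<subseteq> parcs (knight_graph a 1 n d) \<and>
        i < d \<and> (u, v) \<in> F \<and> (u[i := u ! i + a], v[i := v ! i + a]) \<in> F)"

lemma sym_parcs_knight_graph: "sym (parcs (knight_graph a b n d))"
  by (auto simp: sym_def knight_graph_def knight_adj_sym)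

text \<open>Layer \<open>z\<close> offers its edge \<open>u v\<close> to the switch with layer
  \<open>z + 1\<close> and its edge \<open>u' v'\<close> to the one with layer \<open>z - 1\<close>,
  so the switches are disjoint. A third edge \<open>x y\<close> survives in every layer, and its
  copies in layers \<open>0\<close> and \<open>a\<close> are translates along the new axis, which
  has index \<open>0\<close>.\<close>

lemma stackable_tour_Suc:
  assumes "stackable_tour a n d" and a: "0 < a" "a < n"
  shows "stackable_tour a n (Suc d)"
proof -
  obtain F u v i where F: "two_regular (grid n d) F" and conn: "grid n d \<times> grid n d \<subseteq> F\<^sup>*"
    and FE: "F \<subseteq> parcs (knight_graph a 1 n d)" and i: "i < d" and uv: "(u, v) \<in> F"
    and uv': "(u[i := u ! i + a], v[i := v ! i + a]) \<in> F"
    using assms(1) by (auto simp: stackable_tour_def connected_two_factor_def)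
  define u' v' where "u' = u[i := u ! i + a]" and "v' = v[i := v ! i + a]"
  have uv': "(u', v') \<in> F" using uv' by (simp add: u'_def v'_def)
  have Fg: "F \<subseteq> grid n d \<times> grid n d" and symF: "sym F" and irr: "irrefl F"
    and deg: "\<And>x. x \<in> grid n d \<Longrightarrow> card (F `` {x}) = 2"
    using F by (auto simp: two_regular_def)
  have g: "u \<in> grid n d" "v \<in> grid n d" "u' \<in> grid n d" "v' \<in> grid n d"
    using Fg uv uv' by auto
  have len: "length u = d" "length v = d" using g by (auto simp: grid_def)
  have ui: "u' ! i = u ! i + a" "v' ! i = v ! i + a" using i len by (auto simp: u'_def v'_def)
  \<comment> \<open>If \<open>u v\<close> and \<open>u' v'\<close> were the same edge with its ends
    exchanged, the entries of \<open>u\<close> and \<open>v\<close> at \<open>i\<close> would each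
    exceed the other by \<open>a\<close>.\<close>
  have ne: "u \<noteq> u'" "v \<noteq> v'" "\<not> (u = v' \<and> v = u')" using ui a(1) by auto
  let ?V = "grid n (Suc d)"
  let ?E = "parcs (knight_graph a 1 n (Suc d))"
  define L where "L = {(z # x, z # y) | z x y. z < n \<and> (x, y) \<in> F}"
  have LE: "L \<subseteq> ?E"
    using FE by (auto simp: L_def knight_graph_def Cons_in_grid intro: knight_adj_layer)
  have "card (L `` {w}) = 2" if wV: "w \<in> ?V" for w
  proof -
    obtain z x where w: "w = z # x" "z < n" "x \<in> grid n d" using wV by (rule grid_Suc_cases)
    have "L `` {w} = (\<lambda>y. z # y) ` (F `` {x})" using w by (auto simp: L_def)
    also have "card \<dots> = 2" using deg[OF w(3)] by (subst card_image) (auto simp: inj_on_def)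
    finally show ?thesis .
  qed
  moreover have "L \<subseteq> ?V \<times> ?V" using Fg by (auto simp: L_def Cons_in_grid)
  moreover have "sym L" "irrefl L"
    using symF irr by (auto simp: L_def sym_def irrefl_def)
  ultimately have L: "two_regular ?V L" by (auto simp: two_regular_def finite_grid)
  define S where "S = (\<lambda>z. (z # u, z # v, Suc z # u', Suc z # v')) ` {z. Suc z < n}"
  have "\<exists>F'. two_regular ?V F' \<and> F' \<subseteq> ?E \<and> L \<subseteq> F'\<^sup>* \<and> L - \<Union>(switch_edges ` S) \<subseteq> F' \<and>
    (\<forall>(u, v, u', v')\<in>S. (u, u') \<in> F'\<^sup>*)"
  proof (rule switching[OF _ L LE sym_parcs_knight_graph])
    show "finite S" unfolding S_def by (rule finite_imageI, rule finite_subset[of _ "{..<n}"]) auto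
    fix s s' assume "s \<in> S" "s' \<in> S" "s \<noteq> s'"
    then show "switch_edges s \<inter> switch_edges s' = {}"
      using ne by (auto simp: S_def edge_def)
  next
    fix x y x' y' assume "(x, y, x', y') \<in> S"
    then obtain z where z: "Suc z < n" "x = z # u" "y = z # v" "x' = Suc z # u'" "y' = Suc z # v'"
      by (auto simp: S_def)
    have "(x, y) \<in> L" "(x', y') \<in> L" using z uv uv' by (auto simp: L_def)
    moreover have "(x, x') \<in> ?E" "(y, y') \<in> ?E"
      using z g len i a(1) knight_adj_next_layer[of i d u a z] knight_adj_next_layer[of i d v a z]
      by (auto simp: knight_graph_def Cons_in_grid u'_def v'_def)
    ultimately show "(x, y) \<in> L \<and> (x', y') \<in> L \<and> (x, x') \<in> ?E \<and> (y, y') \<in> ?E" by simp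
  qed
  then obtain F' where F': "two_regular ?V F'" "F' \<subseteq> ?E" "L \<subseteq> F'\<^sup>*"
      "L - \<Union>(switch_edges ` S) \<subseteq> F'" "\<forall>(u, v, u', v')\<in>S. (u, u') \<in> F'\<^sup>*"
    by blast
  have symF': "sym (F'\<^sup>*)" using F'(1) by (auto simp: two_regular_def intro: sym_rtrancl)
  have layer: "(z # x, z # y) \<in> F'\<^sup>*" if "z < n" "x \<in> grid n d" "y \<in> grid n d" for z x y
  proof -
    have "(x, y) \<in> F\<^sup>*" using conn that by auto
    then show ?thesis
    proof (induction rule: rtrancl_induct)
      case (step w y)
      then have "(z # w, z # y) \<in> L" using that by (auto simp: L_def)
      with step.IH F'(3) show ?case by (meson rtrancl_trans subsetD)
    qed simp
  qed
  have to0: "(0 # u, z # u) \<in> F'\<^sup>*" if "z < n" for z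
    using that
  proof (induction z)
    case (Suc z)
    then have "(z # u, z # v, Suc z # u', Suc z # v') \<in> S" by (auto simp: S_def)
    then have "(z # u, Suc z # u') \<in> F'\<^sup>*" using F'(5) by auto
    moreover have "(Suc z # u', Suc z # u) \<in> F'\<^sup>*" using layer Suc.prems g by blast
    ultimately show ?case using Suc by (meson rtrancl_trans Suc_lessD)
  qed simp
  have from0: "(0 # u, w) \<in> F'\<^sup>*" if "w \<in> ?V" for w
    using that
  proof (rule grid_Suc_cases)
    fix z x assume "w = z # x" "z < n" "x \<in> grid n d"
    then show ?thesis using to0[of z] layer[of z u x] g by (meson rtrancl_trans)
  qed
  have "(w, w') \<in> F'\<^sup>*" if "w \<in> ?V" "w' \<in> ?V" for w w'
    using symD[OF symF' from0[OF that(1)]] from0[OF that(2)] by (rule rtrancl_trans)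
  then have "?V \<times> ?V \<subseteq> F'\<^sup>*" by auto
  with F'(1) have conn': "connected_two_factor ?V F'" by (simp add: connected_two_factor_def)
  \<comment> \<open>Both \<open>u\<close> and \<open>v\<close> have a second edge besides
    \<open>u v\<close>. If each of these were \<open>u' v'\<close>, then \<open>u = v'\<close> and
    \<open>v = u'\<close>, which \<open>ne\<close> excludes.\<close>
  obtain x y where xy: "(x, y) \<in> F" "(x, y) \<notin> edge u v" "(x, y) \<notin> edge u' v'"
  proof -
    have other: "\<exists>w. (t, w) \<in> F \<and> w \<noteq> s" if "t \<in> grid n d" for s t
    proof -
      from deg[OF that] obtain p q where "F `` {t} = {p, q}" "p \<noteq> q"
        by (auto simp: card_2_iff)
      then show ?thesis by (cases "p = s") auto
    qed
    obtain w1 where w1: "(u, w1) \<in> F" "w1 \<noteq> v" using other[OF g(1)] by blast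
    obtain w2 where w2: "(v, w2) \<in> F" "w2 \<noteq> u" using other[OF g(2)] by blast
    have "u \<noteq> v" "u \<noteq> w1" "v \<noteq> w2" using uv w1 w2 irr by (auto simp: irrefl_def)
    then show thesis
      using that[of u w1] that[of v w2] w1 w2 by (auto simp: edge_def)
  qed
  have kept: "(z # x, z # y) \<in> F'" if "z < n" for z
  proof -
    have "(z # x, z # y) \<in> L" using that xy by (auto simp: L_def)
    moreover have "(z # x, z # y) \<notin> \<Union>(switch_edges ` S)"
      using xy by (auto simp: S_def edge_def)
    ultimately show ?thesis using F'(4) by auto
  qed
  have "(0 # x, 0 # y) \<in> F'" "((0 # x)[0 := (0 # x) ! 0 + a], (0 # y)[0 := (0 # y) ! 0 + a]) \<in> F'"
    using kept[of 0] kept[of a] a by auto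
  with conn' F'(2) show ?thesis
    unfolding stackable_tour_def by blast
qed

section \<open>A spanning 2-regular subgraph of the square board\<close>

definition flip :: "nat \<Rightarrow> nat" where
  "flip x = (if even x then x + 1 else x - 1)"

lemma flip_flip [simp]: "flip (flip x) = x"
  by (auto simp: flip_def)

lemma flip_eq_iff: "flip x = flip y \<longleftrightarrow> x = y"
  by (metis flip_flip)

lemma flip_bounds: "flip x \<le> x + 1" "x \<le> flip x + 1"
  by (auto simp: flip_def)

lemma flip_less_iff: "even m \<Longrightarrow> flip x < m \<longleftrightarrow> x < m"
  unfolding flip_def by presburger

lemma flip_add: "even m \<Longrightarrow> flip (x + m) = flip x + m"
  unfolding flip_def by presburger

lemma flip_diff: "even m \<Longrightarrow> m \<le> x \<Longrightarrow> flip (x - m) = flip x - m"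
  unfolding flip_def by presburger

lemma flip_div2: "flip x div 2 = x div 2"
  unfolding flip_def by presburger

lemma flip_div_mod:
  assumes "even a" "0 < a"
  shows "flip x div a = x div a" "flip x mod a = flip (x mod a)"
proof -
  have "flip x = flip (x mod a + x div a * a)" by simp
  also have "\<dots> = flip (x mod a) + x div a * a" using assms by (intro flip_add) auto
  finally have f: "flip x = flip (x mod a) + x div a * a" .
  have "flip (x mod a) < a" using assms by (simp add: flip_less_iff)
  then show "flip x div a = x div a" "flip x mod a = flip (x mod a)"
    unfolding f using assms by auto
qed

lemma abs_diff_flip: "\<bar>int x - int (flip x)\<bar> = 1"
  by (cases "even x") (auto simp: flip_def of_nat_diff Suc_le_eq odd_pos)

lemma abs_diff_one_parity:
  "\<bar>int y - int y'\<bar> = 1 \<Longrightarrow> even y' \<longleftrightarrow> odd y"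
  by presburger

lemma eq_or_flip_if_div2_eq: "x div 2 = y div 2 \<Longrightarrow> x = y \<or> x = flip y"
  unfolding flip_def by presburger

lemma mod_add_within_block:
  assumes "(y::nat) < m * j" "y mod m + d < m"
  shows "y + d < m * j" "(y + d) mod m = y mod m + d"
proof -
  have "y div m < j" using assms(1) by (metis less_mult_imp_div_less mult.commute)
  then have "m * (y div m) + m \<le> m * j" by (metis Suc_leI mult_Suc_right mult_le_mono2 add.commute)
  moreover have "y + d = m * (y div m) + (y mod m + d)" by simp
  ultimately show "y + d < m * j" using assms(2) by linarith
  have "(y + d) mod m = (y mod m + d) mod m" by (simp add: mod_add_left_eq)
  then show "(y + d) mod m = y mod m + d" using assms(2) by simp
qed

lemma mod_diff_within_block:
  assumes "d \<le> (y::nat) mod m"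
  shows "(y - d) mod m = y mod m - d"
proof -
  have "y - d = m * (y div m) + (y mod m - d)" using assms
    by (metis Nat.add_diff_assoc mult_div_mod_eq)
  then have "(y - d) mod m = (y mod m - d) mod m" by simp
  then show ?thesis
    by (metis less_imp_diff_less mod_less mod_less_divisor neq0_conv mod_by_0 assms)
qed

section \<open>Knight moves in the plane\<close>

lemma pair_in_grid_2: "[x, y] \<in> grid n 2 \<longleftrightarrow> x < n \<and> y < n"
  by (auto simp: grid_def)

lemma grid_2_cases:
  assumes "w \<in> grid n 2"
  obtains x y where "w = [x, y]" "x < n" "y < n"
proof -
  have "length w = Suc (Suc 0)" using assms by (simp add: grid_def)
  then obtain x y where "w = [x, y]" by (auto simp: length_Suc_conv)
  with assms that show thesis by (simp add: pair_in_grid_2)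
qed

lemma knight_adj_2:
  assumes "0 < a" "0 < b"
    and "\<bar>int x - int x'\<bar> = int a \<and> \<bar>int y - int y'\<bar> = int b \<or>
      \<bar>int x - int x'\<bar> = int b \<and> \<bar>int y - int y'\<bar> = int a"
  shows "knight_adj a b 2 [x, y] [x', y']"
proof -
  have "x \<noteq> x'" "y \<noteq> y'" using assms by auto
  then have D: "{k. k < 2 \<and> [x, y] ! k \<noteq> [x', y'] ! k} = {0, 1}"
    by (auto simp: less_2_cases_iff)
  from assms(3) show ?thesis
  proof
    assume "\<bar>int x - int x'\<bar> = int a \<and> \<bar>int y - int y'\<bar> = int b"
    then show ?thesis unfolding knight_adj_def D by - (rule exI[of _ 0], rule exI[of _ 1], auto)
  next
    assume "\<bar>int x - int x'\<bar> = int b \<and> \<bar>int y - int y'\<bar> = int a"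
    then show ?thesis unfolding knight_adj_def D by - (rule exI[of _ 1], rule exI[of _ 0], auto)
  qed
qed

text \<open>\<open>n_eq\<close> cuts the rows into blocks of two heights, and \<open>k_pos\<close>
  makes the lowest block one of height \<open>2 * a\<close>. By \<open>n_ge\<close> every residue
  class modulo \<open>a\<close> has at least ten columns, enough for two triples followed by strips
  of two.\<close>

locale knight_board =
  fixes a n k t :: nat
  assumes even_a: "even a" and a_pos: "0 < a"
    and n_eq: "n = 2 * a * k + (2 * a + 2) * t" and k_pos: "0 < k" and n_ge: "10 * a \<le> n"
begin

lemma even_n: "even n" by (simp add: n_eq)

lemma a_ge2: "2 \<le> a" using even_a a_pos by presburger

text \<open>The columns congruent to \<open>x\<close> modulo \<open>a\<close> are grouped from left to right into \<open>triples x\<close> strips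
  of three columns, on which \<open>col\<close> is 0, 1, 2, followed by strips of two columns, on which it is 3, 4.
  An even number of columns gets two triples rather than none because the links between
  neighbouring residues modulo \<open>a\<close> need a triple.\<close>

definition last_index :: "nat \<Rightarrow> nat" where
  "last_index x = (n - 1 - x mod a) div a"

definition triples :: "nat \<Rightarrow> nat" where
  "triples x = (if even (last_index x) then 1 else 2)"

definition col :: "nat \<Rightarrow> nat" where
  "col x = (if x div a < 3 then x div a else if x div a < 3 * triples x then x div a - 3
     else 3 + (x div a - triples x) mod 2)"

lemma le_last_index_iff: "p \<le> last_index x \<longleftrightarrow> p * a + x mod a < n"
proof -
  have "x mod a < a" using a_pos by simp
  then have "p * a \<le> n - 1 - x mod a \<longleftrightarrow> p * a + x mod a < n" using n_ge by linarith
  then show ?thesis using a_pos by (simp add: last_index_def less_eq_div_iff_mult_less_eq)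
qed

lemma less_n_iff: "x < n \<longleftrightarrow> x div a \<le> last_index x"
  by (simp add: le_last_index_iff)

lemma last_index_ge: "9 \<le> last_index x"
proof -
  have "x mod a < a" using a_pos by simp
  then show ?thesis unfolding le_last_index_iff using n_ge by linarith
qed

text \<open>As \<open>n\<close> and \<open>a\<close> are even, the members of a pair lie on the same
  side of every bound in question, so both have equally many columns and the same pattern of
  strips.\<close>

lemma last_index_flip [simp]: "last_index (flip x) = last_index x"
proof -
  have "p \<le> last_index (flip x) \<longleftrightarrow> p \<le> last_index x" for p
  proof -
    have "p * a + flip (x mod a) = flip (x mod a + p * a)"
      using even_a by (simp add: flip_add)
    then show ?thesis
      using even_n flip_less_iff[OF even_n] by (simp add: le_last_index_iff flip_div_mod even_a a_pos add.commute)
  qed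
  then show ?thesis by (meson order_antisym order_refl)
qed

lemma last_index_add [simp]: "last_index (x + a) = last_index x"
  by (simp add: last_index_def)

lemma div_add_a [simp]: "(x + a) div a = x div a + 1"
  using a_pos by simp

lemma triples_add [simp]: "triples (x + a) = triples x"
  and triples_flip [simp]: "triples (flip x) = triples x"
  by (simp_all add: triples_def)

lemma col_flip [simp]: "col (flip x) = col x"
  by (simp add: col_def flip_div_mod even_a a_pos)

lemma add_less_n_iff: "x + a < n \<longleftrightarrow> x div a < last_index x"
  using less_n_iff[of "x + a"] by auto

lemma flip_less_n [simp]: "flip x < n \<longleftrightarrow> x < n"
  and flip_add_less_n [simp]: "flip x + a < n \<longleftrightarrow> x + a < n"
  using flip_less_iff[OF even_n, of x] flip_less_iff[OF even_n, of "x + a"] even_a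
  by (simp_all add: flip_add)

text \<open>The choice of \<open>triples\<close> leaves an even number of columns, so strips of two
  fill the rest exactly and the last column is the right one of its strip.\<close>

lemma col_right:
  assumes "x < n"
  shows "col x = 0 \<Longrightarrow> x + a < n \<and> col (x + a) = 1"
    and "col x = 1 \<Longrightarrow> x + a < n \<and> col (x + a) = 2"
    and "col x = 2 \<Longrightarrow> x + a < n \<and> (col (x + a) = 0 \<or> col (x + a) = 3)"
    and "col x = 3 \<Longrightarrow> x + a < n \<and> col (x + a) = 4"
    and "col x = 4 \<Longrightarrow> x + a < n \<Longrightarrow> col (x + a) = 3"
    and "n \<le> x + a \<Longrightarrow> col x = 4"
    and "col x \<le> 4"
proof -
  define p L T where "p = x div a" and "L = last_index x" and "T = triples x"
  have pL: "p \<le> L" using assms less_n_iff p_def L_def by simp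
  have L: "9 \<le> L" using last_index_ge L_def by simp
  have c: "col x = (if p < 3 then p else if p < 3 * T then p - 3 else 3 + (p - T) mod 2)"
      "col (x + a) = (if p + 1 < 3 then p + 1 else if p + 1 < 3 * T then p + 1 - 3
        else 3 + (p + 1 - T) mod 2)"
      "x + a < n \<longleftrightarrow> p < L" "n \<le> x + a \<longleftrightarrow> L \<le> p"
    using add_less_n_iff[of x] by (auto simp: col_def p_def L_def T_def)
  have T: "T = 1 \<and> even L \<or> T = 2 \<and> odd L" by (auto simp: T_def L_def triples_def)
  show "col x = 0 \<Longrightarrow> x + a < n \<and> col (x + a) = 1"
    using T unfolding c by (elim disjE; clarsimp split: if_splits) (use L in presburger)+
  show "col x = 1 \<Longrightarrow> x + a < n \<and> col (x + a) = 2"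
    using T unfolding c by (elim disjE; clarsimp split: if_splits) (use L in presburger)+
  show "col x = 2 \<Longrightarrow> x + a < n \<and> (col (x + a) = 0 \<or> col (x + a) = 3)"
    using T unfolding c by (elim disjE; clarsimp split: if_splits) (use L in presburger)+
  show "col x = 3 \<Longrightarrow> x + a < n \<and> col (x + a) = 4"
    using T unfolding c by (elim disjE; clarsimp split: if_splits) (use L pL in presburger)+
  show "col x = 4 \<Longrightarrow> x + a < n \<Longrightarrow> col (x + a) = 3"
    using T unfolding c by (elim disjE; clarsimp split: if_splits) (use L pL in presburger)+
  show "n \<le> x + a \<Longrightarrow> col x = 4"
    using T unfolding c by (elim disjE; clarsimp split: if_splits) (use L pL in presburger)+
  show "col x \<le> 4"
    using T unfolding c by auto
qed

lemma col_left:
  shows "col x = 1 \<Longrightarrow> a \<le> x \<and> col (x - a) = 0"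
    and "col x = 2 \<Longrightarrow> a \<le> x \<and> col (x - a) = 1"
    and "col x = 4 \<Longrightarrow> a \<le> x \<and> col (x - a) = 3"
    and "x < a \<Longrightarrow> col x = 0"
proof -
  have T: "triples y = 1 \<or> triples y = 2" for y by (auto simp: triples_def)
  show c0: "x < a \<Longrightarrow> col x = 0" using T[of x] by (auto simp: col_def)
  have left: "(col (y + a) = 1 \<longrightarrow> col y = 0) \<and> (col (y + a) = 2 \<longrightarrow> col y = 1) \<and>
      (col (y + a) = 4 \<longrightarrow> col y = 3)" for y
  proof -
    define p T where "p = y div a" and "T = triples y"
    have c: "col y = (if p < 3 then p else if p < 3 * T then p - 3 else 3 + (p - T) mod 2)"
        "col (y + a) = (if p + 1 < 3 then p + 1 else if p + 1 < 3 * T then p + 1 - 3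
        else 3 + (p + 1 - T) mod 2)"
      by (auto simp: col_def p_def T_def)
    show ?thesis
      using T[of y, folded T_def] unfolding c by (elim disjE; simp; presburger)
  qed
  show "col x = 1 \<Longrightarrow> a \<le> x \<and> col (x - a) = 0"
      "col x = 2 \<Longrightarrow> a \<le> x \<and> col (x - a) = 1"
      "col x = 4 \<Longrightarrow> a \<le> x \<and> col (x - a) = 3"
    using c0 left[of "x - a"] by (cases "a \<le> x"; simp)+
qed

text \<open>With at least ten columns and at most six of them in triples, the last strip is preceded
  by another strip of two. Links into the last strip therefore stay in rows below \<open>a\<close>,
  away from the links inside it.\<close>

lemma col_left_of_last:
  assumes "x + a < n" "n \<le> x + 3 * a" "col (x + a) = 3"
  shows "col x = 4"
proof -
  define p L T where "p = x div a" and "L = last_index x" and "T = triples x"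
  have L: "9 \<le> L" using last_index_ge L_def by simp
  have "x + a + a + a \<ge> n" using assms(2) by simp
  then have "p + 2 \<ge> L" using add_less_n_iff[of "x + a + a"] by (simp add: p_def L_def)
  moreover have "p < L" using assms(1) add_less_n_iff[of x] by (simp add: p_def L_def)
  moreover have "col x = (if p < 3 then p else if p < 3 * T then p - 3 else 3 + (p - T) mod 2)"
      "col (x + a) = (if p + 1 < 3 then p + 1 else if p + 1 < 3 * T then p + 1 - 3
        else 3 + (p + 1 - T) mod 2)"
    by (auto simp: col_def p_def T_def)
  moreover have "T = 1 \<and> even L \<or> T = 2 \<and> odd L" by (auto simp: T_def L_def triples_def)
  ultimately show ?thesis using assms(3) L
    by (elim disjE conjE; simp) presburger+
qed

text \<open>In the strips of three columns, the rows are cut into \<open>k\<close> blocks of height \<open>2 * a\<close>, followed by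
  \<open>t\<close> wide blocks of height \<open>2 * a + 2\<close>; \<open>loc\<close> is the position inside the block.\<close>

definition wide :: "nat \<Rightarrow> bool" where
  "wide y \<longleftrightarrow> 2 * a * k \<le> y"

definition height :: "nat \<Rightarrow> nat" where
  "height y = (if wide y then 2 * a + 2 else 2 * a)"

definition loc :: "nat \<Rightarrow> nat" where
  "loc y = (if wide y then (y - 2 * a * k) mod (2 * a + 2) else y mod (2 * a))"

section \<open>Moving inside a block of rows\<close>

lemma loc_less: "loc y < height y"
  using a_pos by (auto simp: loc_def height_def)

lemma loc_le: "loc y \<le> y"
  by (auto simp: loc_def intro: order_trans[OF mod_less_eq_dividend diff_le_self])

lemma loc_add:
  assumes "y < n" "loc y + d < height y"
  shows "y + d < n" "loc (y + d) = loc y + d" "wide (y + d) = wide y"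
proof -
  have "y + d < n \<and> loc (y + d) = loc y + d \<and> wide (y + d) = wide y"
  proof (cases "wide y")
    case True
    define z where "z = y - 2 * a * k"
    have y: "y = 2 * a * k + z" using True by (simp add: wide_def z_def)
    then show ?thesis
      using assms True mod_add_within_block[of z "2 * a + 2" t d]
      by (simp add: n_eq height_def loc_def wide_def)
  next
    case False
    then show ?thesis
      using assms mod_add_within_block[of y "2 * a" k d]
      by (simp add: n_eq height_def loc_def wide_def)
  qed
  then show "y + d < n" "loc (y + d) = loc y + d" "wide (y + d) = wide y" by auto
qed

lemma loc_diff:
  assumes "d \<le> loc y"
  shows "loc (y - d) = loc y - d" "wide (y - d) = wide y"
proof -
  have "loc (y - d) = loc y - d \<and> wide (y - d) = wide y"
  proof (cases "wide y")
    case True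
    define z where "z = y - 2 * a * k"
    have y: "y = 2 * a * k + z" using True by (simp add: wide_def z_def)
    have d: "d \<le> z mod (2 * a + 2)" using assms True by (simp add: loc_def z_def)
    then have "d \<le> z" by (meson mod_less_eq_dividend order_trans)
    then have "2 * a * k \<le> y - d" "y - d - 2 * a * k = z - d" using y by auto
    then show ?thesis
      using mod_diff_within_block[OF d] True by (simp add: loc_def wide_def z_def)
  next
    case False
    then show ?thesis
      using assms mod_diff_within_block[of d y "2 * a"] a_pos k_pos
      by (simp add: loc_def wide_def)
  qed
  then show "loc (y - d) = loc y - d" "wide (y - d) = wide y" by auto
qed

lemma even_loc [simp]: "even (loc y) \<longleftrightarrow> even y"
proof (cases "wide y")
  case True
  then show ?thesis by (simp add: loc_def wide_def even_mod_2_iff dvd_mod_iff)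
next
  case False
  then show ?thesis by (simp add: loc_def dvd_mod_iff)
qed

lemma even_height: "even (height y)" by (simp add: height_def)

text \<open>Blocks begin at even rows and have even height, so no pair is split between two
  blocks.\<close>

lemma loc_flip [simp]:
  assumes "y < n"
  shows "loc (flip y) = flip (loc y)" "wide (flip y) = wide y"
proof -
  have "loc (flip y) = flip (loc y) \<and> wide (flip y) = wide y"
  proof (cases "even y")
    case True
    moreover from this have "loc y + 1 < height y"
      using loc_less[of y] even_height[of y] even_loc[of y] by presburger
    ultimately show ?thesis
      using loc_add[OF assms, of 1] by (simp add: flip_def)
  next
    case False
    moreover from this have "1 \<le> loc y" using even_loc[of y] by presburger
    ultimately show ?thesis
      using loc_diff[of 1 y] by (simp add: flip_def)
  qed
  then show "loc (flip y) = flip (loc y)" "wide (flip y) = wide y" by auto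
qed

lemma first_block:
  assumes "y < 2 * a"
  shows "\<not> wide y" "loc y = y"
proof -
  have "2 * a * 1 \<le> 2 * a * k" using k_pos by (intro mult_left_mono) auto
  then show "\<not> wide y" using assms unfolding wide_def by linarith
  then show "loc y = y" using assms by (simp add: loc_def)
qed

text \<open>\<open>vert x y\<close> selects the edge from \<open>(x, y)\<close> to \<open>(flip x, y + a)\<close>, and \<open>horiz x y y'\<close> the edge from
  \<open>(x, y)\<close> to \<open>(x + a, y')\<close>. Only the steps out of the left column of a wide block cross the pairs
  \<open>{2s, 2s + 1}\<close>; there \<open>y' = y + 1\<close> below the rows \<open>a, a + 1\<close> and \<open>y' = y - 1\<close> above them, whatever
  the parity of \<open>y\<close>.\<close>

definition vert :: "nat \<Rightarrow> nat \<Rightarrow> bool" where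
  "vert x y \<longleftrightarrow> x < n \<and> y + a < n \<and>
     (3 \<le> col x \<or> (col x = 0 \<or> col x = 2) \<and> loc y + a < height y \<or>
      col x = 1 \<and> wide y \<and> (loc y = 0 \<or> loc y = a + 1))"

definition horiz :: "nat \<Rightarrow> nat \<Rightarrow> nat \<Rightarrow> bool" where
  "horiz x y y' \<longleftrightarrow> x < n \<and> y < n \<and> y' < n \<and>
     (col x = 0 \<and> (if wide y then loc y < a \<and> y' = y + 1 \<or> a + 2 \<le> loc y \<and> y = y' + 1
                    else y' = flip y) \<or>
      col x = 1 \<and> (wide y \<longrightarrow> loc y \<noteq> a \<and> loc y \<noteq> a + 1) \<and> y' = flip y \<or>
      col x = 3 \<and> (y < a \<or> n \<le> y + a) \<and> y' = flip y)"

section \<open>The 2-factor and its degrees\<close>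

definition factor_arcs where
  "factor_arcs = {([x, y], [flip x, y + a]) | x y. vert x y} \<union> {([x, y], [x + a, y']) | x y y'. horiz x y y'}"

definition factor where
  "factor = factor_arcs \<union> factor_arcs\<inverse>"

lemma vert_flip [simp]: "vert (flip x) y = vert x y"
  by (simp add: vert_def)

text \<open>The degree count needs the edge arriving from below in terms of its upper end. In the
  strips of three columns a vertical edge never leaves its block, so \<open>loc\<close> grows along
  it by exactly \<open>a\<close>.\<close>

lemma vert_below:
  assumes "a \<le> y" "x < n" "y < n"
  shows "vert x (y - a) \<longleftrightarrow> 3 \<le> col x \<or> (col x = 0 \<or> col x = 2) \<and> a \<le> loc y \<or>
    col x = 1 \<and> wide y \<and> (loc y = a \<or> loc y = 2 * a + 1)"
proof -
  define z where "z = y - a"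
  have y: "y = z + a" "z < n" using assms by (auto simp: z_def)
  have up: "loc y = loc z + a \<and> wide y = wide z" if "loc z + a < height z"
    using loc_add[OF y(2) that] y(1) by simp
  have dn: "loc z = loc y - a \<and> wide z = wide y \<and> loc z + a < height z" if "a \<le> loc y"
    using loc_diff[OF that] that loc_less[of y] y(1) by (simp add: height_def)
  have "loc z + a < height z \<longleftrightarrow> a \<le> loc y" using up dn by (metis le_add2)
  moreover have "wide z \<and> (loc z = 0 \<or> loc z = a + 1) \<longleftrightarrow> wide y \<and> (loc y = a \<or> loc y = 2 * a + 1)"
    (is "?L \<longleftrightarrow> ?R")
  proof
    assume L: ?L
    then have "loc z + a < height z" by (auto simp: height_def)
    from up[OF this] L show ?R by auto
  next
    assume R: ?R
    then have "a \<le> loc y" by auto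
    from dn[OF this] R show ?L by auto
  qed
  moreover have "z + a < n" using y assms by simp
  ultimately show ?thesis using assms(2) unfolding vert_def z_def[symmetric] by blast
qed

text \<open>In a wide block the shifted steps lead from rows \<open>0\<close> to
  \<open>a - 1\<close> of the left column to rows \<open>1\<close> to \<open>a\<close> of the middle
  one, and from rows \<open>a + 2\<close> to \<open>2 * a + 1\<close> to rows \<open>a + 1\<close>
  to \<open>2 * a\<close>. Rows \<open>0\<close> and \<open>2 * a + 1\<close> of the middle column
  receive nothing.\<close>

lemma horiz_into_col_1:
  assumes x: "x < n" "col x = 1" and y: "y < n"
  shows "{y'. horiz (x - a) y' y} =
    (if \<not> wide y then {flip y} else if 1 \<le> loc y \<and> loc y \<le> a then {y - 1}
     else if a + 1 \<le> loc y \<and> loc y \<le> 2 * a then {y + 1} else {})"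
proof -
  have c: "a \<le> x" "col (x - a) = 0" "x - a < n" using col_left(1)[OF x(2)] x(1) by auto
  have h: "horiz (x - a) y' y \<longleftrightarrow> y' < n \<and>
      (if wide y' then loc y' < a \<and> y = y' + 1 \<or> a + 2 \<le> loc y' \<and> y' = y + 1 else y = flip y')" for y'
    using c y by (auto simp: horiz_def)
  have fl: "y = flip y' \<longleftrightarrow> y' = flip y" for y' by auto
  have below: "loc y = loc y' + 1 \<and> wide y" if "wide y'" "loc y' < a" "y = y' + 1" "y' < n" for y'
    using loc_add[of y' 1] that by (simp add: height_def)
  have above: "loc y' = loc y + 1 \<and> wide y \<and> loc y \<le> 2 * a"
    if "wide y'" "a + 2 \<le> loc y'" "y' = y + 1" for y'
    using loc_diff[of 1 y'] loc_less[of y'] that by (simp add: height_def)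
  have below': "wide (y - 1) \<and> loc (y - 1) < a \<and> y = y - 1 + 1" if "wide y" "1 \<le> loc y" "loc y \<le> a"
    using loc_diff[of 1 y] that loc_le[of y] by auto
  have above': "wide (y + 1) \<and> a + 2 \<le> loc (y + 1) \<and> y + 1 < n"
    if "wide y" "a + 1 \<le> loc y" "loc y \<le> 2 * a"
    using loc_add[OF y, of 1] that by (simp add: height_def)
  show ?thesis
  proof (cases "wide y")
    case False
    have "horiz (x - a) y' y \<longleftrightarrow> y' = flip y" for y'
    proof (cases "wide y'")
      case True
      then have "\<not> (loc y' < a \<and> y = y' + 1 \<and> y' < n)" "\<not> (a + 2 \<le> loc y' \<and> y' = y + 1)"
        using below[of y'] above[of y'] False by blast+
      moreover have "y' \<noteq> flip y" using True False y by auto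
      ultimately show ?thesis unfolding h using True by auto
    qed (use fl[of y'] y in \<open>auto simp: h\<close>)
    then show ?thesis using False by auto
  next
    case True
    have nf: "wide y'" if "y = flip y'" "y' < n" for y' using True that by auto
    have "horiz (x - a) y' y \<longleftrightarrow>
      (1 \<le> loc y \<and> loc y \<le> a \<and> y' = y - 1 \<or> a + 1 \<le> loc y \<and> loc y \<le> 2 * a \<and> y' = y + 1)"
      (is "_ \<longleftrightarrow> ?R y'") for y'
    proof
      assume "horiz (x - a) y' y"
      then have y': "y' < n" "if wide y' then loc y' < a \<and> y = y' + 1 \<or> a + 2 \<le> loc y' \<and> y' = y + 1
          else y = flip y'"
        unfolding h by auto
      then have w: "wide y'" using nf[of y'] by (cases "wide y'") simp_all
      with y' consider "loc y' < a" "y = y' + 1" | "a + 2 \<le> loc y'" "y' = y + 1" by auto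
      then show "?R y'"
      proof cases
        case 1
        with below[OF w] y' show ?thesis by simp
      next
        case 2
        with above[OF w] show ?thesis by simp
      qed
    next
      assume "?R y'"
      then show "horiz (x - a) y' y"
      proof (elim disjE conjE)
        assume l: "1 \<le> loc y" "loc y \<le> a" "y' = y - 1"
        from below'[OF True l(1,2)] l(3) y show ?thesis unfolding h by simp
      next
        assume l: "a + 1 \<le> loc y" "loc y \<le> 2 * a" "y' = y + 1"
        from above'[OF True l(1,2)] l(3) show ?thesis unfolding h by simp
      qed
    qed
    then show ?thesis using True by auto
  qed
qed

lemma flip_loc_pair: "flip l = a \<or> flip l = a + 1 \<longleftrightarrow> l = a \<or> l = a + 1"
  using even_a unfolding flip_def by presburger

lemma horiz_into_col_2:
  assumes x: "x < n" "col x = 2" and y: "y < n"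
  shows "{y'. horiz (x - a) y' y} = (if wide y \<and> (loc y = a \<or> loc y = a + 1) then {} else {flip y})"
proof -
  have c: "col (x - a) = 1" "x - a < n" using col_left(2)[OF x(2)] x(1) by auto
  have "horiz (x - a) y' y \<longleftrightarrow> y' = flip y \<and> \<not> (wide y \<and> (loc y = a \<or> loc y = a + 1))" for y'
  proof
    assume h: "horiz (x - a) y' y"
    then have "y' = flip y" using c by (auto simp: horiz_def)
    with h c y flip_loc_pair[of "loc y"] show "y' = flip y \<and> \<not> (wide y \<and> (loc y = a \<or> loc y = a + 1))"
      by (auto simp: horiz_def)
  next
    assume "y' = flip y \<and> \<not> (wide y \<and> (loc y = a \<or> loc y = a + 1))"
    with c y flip_loc_pair[of "loc y"] show "horiz (x - a) y' y" by (auto simp: horiz_def)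
  qed
  then show ?thesis by auto
qed

lemma horiz_into_col_4:
  assumes x: "x < n" "col x = 4" and y: "y < n"
  shows "{y'. horiz (x - a) y' y} = (if y < a \<or> n \<le> y + a then {flip y} else {})"
proof -
  have c: "col (x - a) = 3" "x - a < n" using col_left(3)[OF x(2)] x(1) by auto
  have fl: "flip y < a \<longleftrightarrow> y < a" "n \<le> flip y + a \<longleftrightarrow> n \<le> y + a"
    using flip_less_iff[OF even_a, of y] flip_add_less_n[of y] by (simp, linarith)
  have "horiz (x - a) y' y \<longleftrightarrow> y' = flip y \<and> (y < a \<or> n \<le> y + a)" for y'
  proof
    assume h: "horiz (x - a) y' y"
    then have "y' = flip y" using c by (auto simp: horiz_def)
    with h c fl show "y' = flip y \<and> (y < a \<or> n \<le> y + a)" by (auto simp: horiz_def)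
  next
    assume "y' = flip y \<and> (y < a \<or> n \<le> y + a)"
    with c y fl show "horiz (x - a) y' y" by (auto simp: horiz_def)
  qed
  then show ?thesis by auto
qed

lemma horiz_into_none:
  assumes "x < n" "col x = 0 \<or> col x = 3"
  shows "{y'. a \<le> x \<and> horiz (x - a) y' y} = {}"
proof -
  have False if "a \<le> x" "horiz (x - a) y' y" for y'
  proof -
    have "x - a < n" "x - a + a = x" using assms that by auto
    then show False
      using that assms col_right(1,2,4)[of "x - a"] by (auto simp: horiz_def)
  qed
  then show ?thesis by auto
qed

lemma horiz_from:
  assumes "x < n" "y < n"
  shows "col x = 0 \<Longrightarrow> {y'. horiz x y y'} =
      (if \<not> wide y then {flip y} else if loc y < a then {y + 1}
       else if a + 2 \<le> loc y then {y - 1} else {})"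
    and "col x = 1 \<Longrightarrow> {y'. horiz x y y'} =
      (if wide y \<and> (loc y = a \<or> loc y = a + 1) then {} else {flip y})"
    and "col x = 3 \<Longrightarrow> {y'. horiz x y y'} = (if y < a \<or> n \<le> y + a then {flip y} else {})"
    and "col x = 2 \<or> col x = 4 \<Longrightarrow> {y'. horiz x y y'} = {}"
proof -
  assume c: "col x = 0"
  have "y + 1 < n" if "wide y" "loc y < a"
    using loc_add[OF assms(2), of 1] that by (simp add: height_def)
  then show "{y'. horiz x y y'} =
      (if \<not> wide y then {flip y} else if loc y < a then {y + 1}
       else if a + 2 \<le> loc y then {y - 1} else {})"
    using c assms loc_le[of y] by (auto simp: horiz_def)
qed (use assms in \<open>auto simp: horiz_def\<close>)

lemma factor_neighbours:
  assumes "x < n" "y < n"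
  shows "factor `` {[x, y]} =
    (if vert x y then {[flip x, y + a]} else {}) \<union> (if a \<le> y \<and> vert x (y - a) then {[flip x, y - a]} else {}) \<union>
    (\<lambda>y'. [x + a, y']) ` {y'. horiz x y y'} \<union> (\<lambda>y'. [x - a, y']) ` {y'. a \<le> x \<and> horiz (x - a) y' y}"
    (is "?L = ?A \<union> ?B \<union> ?C \<union> ?D")
proof (rule equalityI)
  show "?L \<subseteq> ?A \<union> ?B \<union> ?C \<union> ?D"
    by (auto simp: factor_def factor_arcs_def)
  have "?A \<subseteq> ?L" by (auto simp: factor_def factor_arcs_def)
  moreover have "?B \<subseteq> ?L"
  proof -
    have "([x, y], [flip x, y - a]) \<in> factor_arcs\<inverse>" if "a \<le> y" "vert x (y - a)"
    proof -
      have "vert (flip x) (y - a)" using that by simp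
      then have "([flip x, y - a], [flip (flip x), y - a + a]) \<in> factor_arcs" unfolding factor_arcs_def by blast
      then show ?thesis using that(1) by simp
    qed
    then show ?thesis by (auto simp: factor_def)
  qed
  moreover have "?C \<subseteq> ?L" by (auto simp: factor_def factor_arcs_def)
  moreover have "?D \<subseteq> ?L"
  proof -
    have "([x, y], [x - a, y']) \<in> factor_arcs\<inverse>" if "a \<le> x" "horiz (x - a) y' y" for y'
    proof -
      have "([x - a, y'], [x - a + a, y]) \<in> factor_arcs" using that(2) unfolding factor_arcs_def by blast
      then show ?thesis using that(1) by simp
    qed
    then show ?thesis by (auto simp: factor_def)
  qed
  ultimately show "?A \<union> ?B \<union> ?C \<union> ?D \<subseteq> ?L" by blast
qed

lemma flip_neq_shift: "flip x \<noteq> x + a" "a \<le> x \<Longrightarrow> flip x \<noteq> x - a"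
  using flip_bounds[of x] a_ge2 by linarith+

text \<open>Vertical edges change the first coordinate by 1 and horizontal ones by \<open>a\<close>,
  which is at least 2, so the neighbours in the four directions are distinct.\<close>

lemma card_factor_neighbours:
  assumes "x < n" "y < n"
  shows "card (factor `` {[x, y]}) =
    of_bool (vert x y) + of_bool (a \<le> y \<and> vert x (y - a)) +
    card {y'. horiz x y y'} + card {y'. a \<le> x \<and> horiz (x - a) y' y}"
proof -
  define A B C D where "A = (if vert x y then {[flip x, y + a]} else {})"
    and "B = (if a \<le> y \<and> vert x (y - a) then {[flip x, y - a]} else {})"
    and "C = (\<lambda>y'. [x + a, y']) ` {y'. horiz x y y'}"
    and "D = (\<lambda>y'. [x - a, y']) ` {y'. a \<le> x \<and> horiz (x - a) y' y}"
  have fin: "finite A" "finite B" "finite C" "finite D"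
    by (auto simp: A_def B_def C_def D_def horiz_def)
  have "A \<inter> B = {}" using a_pos by (auto simp: A_def B_def)
  moreover have "(A \<union> B) \<inter> C = {}" using flip_neq_shift(1) by (auto simp: A_def B_def C_def)
  moreover have "(A \<union> B \<union> C) \<inter> D = {}"
    using flip_neq_shift(2) a_pos by (auto simp: A_def B_def C_def D_def)
  ultimately have "card (A \<union> B \<union> C \<union> D) = card A + card B + card C + card D"
    using fin by (simp add: card_Un_disjoint)
  moreover have "card A = of_bool (vert x y)" "card B = of_bool (a \<le> y \<and> vert x (y - a))"
    by (auto simp: A_def B_def)
  moreover have "card C = card {y'. horiz x y y'}" "card D = card {y'. a \<le> x \<and> horiz (x - a) y' y}"
    unfolding C_def D_def by (auto intro!: card_image inj_onI)
  ultimately show ?thesis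
    unfolding factor_neighbours[OF assms] A_def[symmetric] B_def[symmetric] C_def[symmetric] D_def[symmetric]
    by simp
qed

lemma vert_sides:
  assumes "x < n" "y < n" "col x = 0 \<or> col x = 2"
  shows "vert x y \<longleftrightarrow> loc y + a < height y" "a \<le> y \<and> vert x (y - a) \<longleftrightarrow> a \<le> loc y"
proof -
  show "vert x y \<longleftrightarrow> loc y + a < height y"
    using assms loc_add(1)[OF assms(2), of a] by (auto simp: vert_def)
  show "a \<le> y \<and> vert x (y - a) \<longleftrightarrow> a \<le> loc y"
    using assms vert_below[of y x] loc_le[of y] by auto
qed

lemma vert_middle:
  assumes "x < n" "y < n" "col x = 1"
  shows "vert x y \<longleftrightarrow> wide y \<and> (loc y = 0 \<or> loc y = a + 1)"
    "a \<le> y \<and> vert x (y - a) \<longleftrightarrow> wide y \<and> (loc y = a \<or> loc y = 2 * a + 1)"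
proof -
  have "y + a < n" if "wide y" "loc y = 0 \<or> loc y = a + 1"
    using that loc_add(1)[OF assms(2), of a] by (auto simp: height_def)
  then show "vert x y \<longleftrightarrow> wide y \<and> (loc y = 0 \<or> loc y = a + 1)"
    using assms by (auto simp: vert_def)
  show "a \<le> y \<and> vert x (y - a) \<longleftrightarrow> wide y \<and> (loc y = a \<or> loc y = 2 * a + 1)"
    using assms vert_below[of y x] loc_le[of y] by auto
qed

text \<open>In the outer columns of a wide block, rows \<open>a\<close> and \<open>a + 1\<close>
  have two vertical edges and no horizontal one. In its middle column the vertical edges from row
  \<open>0\<close> to \<open>a\<close> and from \<open>a + 1\<close> to \<open>2 * a + 1\<close>
  make up for one missing horizontal edge at each end. In a strip of two, the horizontal edges sit
  where one vertical edge is missing.\<close>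

lemma degree_factor:
  assumes x: "x < n" and y: "y < n"
  shows "card (factor `` {[x, y]}) = 2"
proof -
  note N = card_factor_neighbours[OF x y]
  have l: "loc y < (if wide y then 2 * a + 2 else 2 * a)"
    using loc_less[of y] by (simp add: height_def)
  consider "col x = 0" | "col x = 1" | "col x = 2" | "col x = 3" | "col x = 4"
    using col_right(7)[OF x] by linarith
  then show ?thesis
  proof cases
    case 1
    then have c: "col x = 0 \<or> col x = 2" "col x = 0 \<or> col x = 3" by auto
    show ?thesis
      unfolding N horiz_from(1)[OF x y 1] horiz_into_none[OF x c(2)] vert_sides[OF x y c(1)] height_def
      using l a_ge2 by auto
  next
    case 2
    have e: "{y'. a \<le> x \<and> horiz (x - a) y' y} = {y'. horiz (x - a) y' y}"
      using col_left(1)[OF 2] by simp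
    show ?thesis
      unfolding N e horiz_from(2)[OF x y 2] horiz_into_col_1[OF x 2 y] vert_middle[OF x y 2]
      using l a_ge2 by auto
  next
    case 3
    then have c: "col x = 0 \<or> col x = 2" "col x = 2 \<or> col x = 4" by auto
    have e: "{y'. a \<le> x \<and> horiz (x - a) y' y} = {y'. horiz (x - a) y' y}"
      using col_left(2)[OF 3] by simp
    show ?thesis
      unfolding N e horiz_from(4)[OF x y c(2)] horiz_into_col_2[OF x 3 y] vert_sides[OF x y c(1)] height_def
      using l a_ge2 by auto
  next
    case 4
    then have c: "col x = 0 \<or> col x = 3" by auto
    have v: "vert x y \<longleftrightarrow> y + a < n" "a \<le> y \<and> vert x (y - a) \<longleftrightarrow> a \<le> y"
      using x y 4 vert_below[of y x] by (auto simp: vert_def)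
    show ?thesis
      unfolding N v horiz_from(3)[OF x y 4] horiz_into_none[OF x c] using n_ge a_pos by auto
  next
    case 5
    then have c: "col x = 2 \<or> col x = 4" by auto
    have e: "{y'. a \<le> x \<and> horiz (x - a) y' y} = {y'. horiz (x - a) y' y}"
      using col_left(3)[OF 5] by simp
    have v: "vert x y \<longleftrightarrow> y + a < n" "a \<le> y \<and> vert x (y - a) \<longleftrightarrow> a \<le> y"
      using x y 5 vert_below[of y x] by (auto simp: vert_def)
    show ?thesis
      unfolding N v e horiz_from(4)[OF x y c] horiz_into_col_4[OF x 5 y] using n_ge a_pos by auto
  qed
qed

lemma factor_arcs_subset: "factor_arcs \<subseteq> parcs (knight_graph a 1 n 2)"
proof -
  have "knight_adj a 1 2 [x, y] [flip x, y + a]" for x y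
    using a_pos abs_diff_flip by (intro knight_adj_2) auto
  moreover have "x + a < n \<and> knight_adj a 1 2 [x, y] [x + a, y']" if "horiz x y y'" for x y y'
  proof
    show "x + a < n" using that col_right[of x] by (auto simp: horiz_def)
    have "\<bar>int y - int y'\<bar> = 1" using that abs_diff_flip[of y] by (auto simp: horiz_def split: if_splits)
    then show "knight_adj a 1 2 [x, y] [x + a, y']" using a_pos by (intro knight_adj_2) auto
  qed
  ultimately show ?thesis
    by (auto simp: factor_arcs_def knight_graph_def pair_in_grid_2 vert_def) (auto simp: horiz_def)
qed

lemma factor_subset: "factor \<subseteq> parcs (knight_graph a 1 n 2)"
  using factor_arcs_subset sym_parcs_knight_graph[of a 1 n 2] by (auto simp: factor_def dest: symD)

lemma two_regular_factor: "two_regular (grid n 2) factor"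
proof -
  have "factor \<subseteq> grid n 2 \<times> grid n 2" using factor_subset by (auto simp: knight_graph_def)
  moreover have "irrefl factor"
    using factor_subset by (auto simp: irrefl_def knight_graph_def knight_adj_irrefl)
  moreover have "sym factor" by (auto simp: factor_def sym_def)
  moreover have "card (factor `` {w}) = 2" if "w \<in> grid n 2" for w
    using grid_2_cases[OF that] degree_factor by metis
  ultimately show ?thesis by (simp add: two_regular_def finite_grid)
qed

section \<open>Merging the components on the square board\<close>

text \<open>A link \<open>(x, y, x', y')\<close> stands for the switch of the parallel edges with lower (or left) ends
  \<open>(x, y)\<close> and \<open>(x', y')\<close>. The first kind joins every strip to the next one; the other two, inside the last
  strip, cross the pairs of rows. Links in \<open>hlinks\<close> cross the pairs of columns.\<close>

definition vlinks :: "(nat \<times> nat \<times> nat \<times> nat) set" where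
  "vlinks = {(x, y, x', y').
     x' = x + a \<and> y' = flip y \<and> x' < n \<and> y < n \<and>
       (col x = 2 \<and> loc y + a < height y \<or> col x = 4 \<and> y < a) \<or>
     x' = x + a \<and> y' = y + 1 \<and> x' < n \<and> n \<le> x' + a \<and> odd y \<and> a < y \<and> y < 2 * a \<or>
     x = x' + a \<and> y' = y + 1 \<and> x < n \<and> n \<le> x + a \<and> odd y \<and> a < y \<and> y < 2 * a}"

definition hlinks :: "(nat \<times> nat \<times> nat \<times> nat) set" where
  "hlinks = {(x, y, x', y'). x' = x + 1 \<and> y' = y + a \<and> odd x \<and> x < a \<and> y < 2}"

fun vswitch :: "nat \<times> nat \<times> nat \<times> nat \<Rightarrow> nat list switch" where
  "vswitch (x, y, x', y') = ([x, y], [flip x, y + a], [x', y'], [flip x', y' + a])"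

fun hswitch :: "nat \<times> nat \<times> nat \<times> nat \<Rightarrow> nat list switch" where
  "hswitch (x, y, x', y') = ([x, y], [x + a, flip y], [x', y'], [x' + a, flip y'])"

lemma col_last:
  assumes "x < n" "n \<le> x + a"
  shows "col x = 4" "a \<le> x" "col (x - a) = 3"
  using col_right(6)[OF assms] col_left(3)[of x] by auto

text \<open>Adds the values of \<open>col\<close> at both ends and the row bound in the last strip,
  by which different links are told apart.\<close>

lemma vlinks_cases:
  assumes "(x, y, x', y') \<in> vlinks"
  obtains (across) "x' = x + a" "y' = flip y" "x' < n" "y < n" "vert x y"
      "col x = 2 \<or> col x = 4" "col x' = 0 \<or> col x' = 3" "n \<le> x' + 2 * a \<Longrightarrow> col x' = 3 \<Longrightarrow> y' < a"
    | (right) "x' = x + a" "y' = y + 1" "x' < n" "n \<le> x' + a" "col x = 3" "col x' = 4"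
      "odd y" "a < y" "y < 2 * a"
    | (left) "x = x' + a" "y' = y + 1" "x < n" "n \<le> x + a" "col x' = 3" "col x = 4"
      "odd y" "a < y" "y < 2 * a"
proof -
  consider (1) "x' = x + a" "y' = flip y" "x' < n" "y < n"
       "col x = 2 \<and> loc y + a < height y \<or> col x = 4 \<and> y < a" |
     (2) "x' = x + a" "y' = y + 1" "x' < n" "n \<le> x' + a" "odd y" "a < y" "y < 2 * a" |
     (3) "x = x' + a" "y' = y + 1" "x < n" "n \<le> x + a" "odd y" "a < y" "y < 2 * a"
    using assms by (auto simp: vlinks_def)
  then show thesis
  proof cases
    case 1
    have "vert x y"
      using 1 vert_sides(1)[of x y] n_ge by (auto simp: vert_def)
    moreover have "col x' = 0 \<or> col x' = 3"
      using 1 col_right(3,5)[of x] by auto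
    moreover have "y' < a" if "n \<le> x' + 2 * a" "col x' = 3"
    proof -
      have "col x = 4" using col_left_of_last[of x] that 1 by auto
      then show ?thesis using 1 flip_less_iff[OF even_a] by auto
    qed
    ultimately show ?thesis using across 1 by blast
  next
    case 2
    then show ?thesis using right col_last[of x'] by auto
  next
    case 3
    then show ?thesis using left col_last[of x] by auto
  qed
qed

lemma vlinks_valid:
  assumes "(x, y, x', y') \<in> vlinks"
  shows "vert x y" "vert x' y'" "\<bar>int x - int x'\<bar> = int a" "\<bar>int y - int y'\<bar> = 1"
proof -
  from assms have "vert x y \<and> vert x' y' \<and> \<bar>int x - int x'\<bar> = int a \<and> \<bar>int y - int y'\<bar> = 1"
  proof (cases rule: vlinks_cases)
    case across
    have y: "y + a < n" using across(5) by (simp add: vert_def)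
    have "vert x' y'"
    proof (cases "col x' = 3")
      case True
      then show ?thesis using across y by (auto simp: vert_def)
    next
      case False
      then have c: "col x' = 0" using across by auto
      then have "col x = 2" using across col_right(5)[of x] by auto
      then have "loc y + a < height y" using across vert_sides(1)[of x y] by auto
      \<comment> \<open>An even bound is respected by a row exactly if it is respected by its
        partner.\<close>
      moreover have "even (height y - a)" using even_height even_a by simp
      ultimately have "flip (loc y) + a < height y"
        using flip_less_iff[of "height y - a" "loc y"] by linarith
      then show ?thesis
        using c across y by (simp add: vert_def height_def)
    qed
    then show ?thesis using across abs_diff_flip[of y] by auto
  next
    case right
    then show ?thesis using n_ge by (auto simp: vert_def)
  next
    case left
    then show ?thesis using n_ge by (auto simp: vert_def)
  qed
  then show "vert x y" "vert x' y'" "\<bar>int x - int x'\<bar> = int a" "\<bar>int y - int y'\<bar> = 1" by auto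
qed

text \<open>Column \<open>x + 1\<close> is a left column again, or the middle column
  \<open>a\<close> if \<open>x = a - 1\<close>. The rows lie in the lowest block, which is not wide,
  so the steps go to the partner row.\<close>

lemma hlinks_valid:
  assumes "(x, y, x', y') \<in> hlinks"
  shows "horiz x y (flip y)" "horiz x' y' (flip y')"
proof -
  have x: "x' = x + 1" "y' = y + a" "odd x" "x < a" "y < 2" using assms by (auto simp: hlinks_def)
  have fy: "flip y < 2" using x(5) flip_less_iff[of 2 y] by simp
  have c: "col x = 0" using col_left(4)[OF x(4)] .
  have c': "col x' = 0 \<or> col x' = 1"
  proof (cases "x' < a")
    case False
    then have "x' = 0 + a" using x by simp
    then show ?thesis using col_right(1)[of 0] col_left(4)[of 0] a_pos n_ge by auto
  qed (use col_left(4) in auto)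
  have "y < 2 * a" "y' < 2 * a" using x a_ge2 by auto
  then have w: "\<not> wide y" "\<not> wide y'" using first_block by auto
  have fy': "flip y' = flip y + a" using x(2) even_a by (simp add: flip_add)
  show "horiz x y (flip y)" using c w x fy n_ge a_ge2 by (auto simp: horiz_def)
  show "horiz x' y' (flip y')"
    using c' w x fy fy' n_ge a_ge2 by (auto simp: horiz_def)
qed

text \<open>Links between strips start in columns with \<open>col\<close> 2 or 4 and end in columns
  with \<open>col\<close> 0 or 3. In the last strip rows decide: links from outside end below row
  \<open>a\<close>, the others lie above it, and of those the ones going right and the ones going
  left meet each column in rows of opposite parity.\<close>

lemma vlinks_matching:
  assumes q: "(x, y, x', y') \<in> vlinks" and r: "(u, v, u', v') \<in> vlinks"
    and meet: "{(x, y), (x', y')} \<inter> {(u, v), (u', v')} \<noteq> {}"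
  shows "(x, y, x', y') = (u, v, u', v')"
proof -
  have m: "x = u \<and> y = v \<or> x = u' \<and> y = v' \<or> x' = u \<and> y' = v \<or> x' = u' \<and> y' = v'"
    using meet by auto
  show ?thesis using q
  proof (cases rule: vlinks_cases)
    case across
    note A = across
    show ?thesis using r
    proof (cases rule: vlinks_cases)
      case across
      then show ?thesis using A m by (auto simp: flip_eq_iff)
    next
      case right
      then show ?thesis using A m by auto
    next
      case left
      then show ?thesis using A m by auto
    qed
  next
    case right
    note A = right
    show ?thesis using r
    proof (cases rule: vlinks_cases)
      case across
      then show ?thesis using A m by auto
    next
      case right
      then show ?thesis using A m by auto
    next
      case left
      then show ?thesis using A m by auto
    qed
  next
    case left
    note A = left
    show ?thesis using r
    proof (cases rule: vlinks_cases)
      case across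
      then show ?thesis using A m by auto
    next
      case right
      then show ?thesis using A m by auto
    next
      case left
      then show ?thesis using A m by auto
    qed
  qed
qed

section \<open>Validity and disjointness of the switches\<close>

lemma edge_vert_meet:
  "edge [x, y] [flip x, y + a] \<inter> edge [u, v] [flip u, v + a] \<noteq> {} \<Longrightarrow> x = u \<and> y = v"
  using a_pos by (auto simp: edge_def)

lemma edge_horiz_meet:
  "edge [x, y] [x + a, flip y] \<inter> edge [u, v] [u + a, flip v] \<noteq> {} \<Longrightarrow> x = u \<and> y = v"
  using a_pos by (auto simp: edge_def)

lemma edge_vert_horiz_meet:
  "edge [x, y] [flip x, y + a] \<inter> edge [u, v] [u + a, flip v] = {}"
proof -
  have "flip z \<noteq> z + a" "z \<noteq> flip z + a" for z using flip_bounds[of z] a_ge2 by linarith+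
  then show ?thesis using even_a by (auto simp: edge_def flip_add)
qed

definition switches where
  "switches = vswitch ` vlinks \<union> hswitch ` hlinks"

lemma switches_valid:
  assumes "(u, v, u', v') \<in> switches"
  shows "(u, v) \<in> factor \<and> (u', v') \<in> factor \<and>
    (u, u') \<in> parcs (knight_graph a 1 n 2) \<and> (v, v') \<in> parcs (knight_graph a 1 n 2)"
proof -
  let ?E = "parcs (knight_graph a 1 n 2)"
  have adj: "(u, u') \<in> ?E \<and> (v, v') \<in> ?E"
    if "(u, v) \<in> factor" "(u', v') \<in> factor" "knight_adj a 1 2 u u'" "knight_adj a 1 2 v v'"
    using that factor_subset by (auto simp: knight_graph_def)
  from assms consider x y x' y' where "(x, y, x', y') \<in> vlinks"
      "(u, v, u', v') = ([x, y], [flip x, y + a], [x', y'], [flip x', y' + a])"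
    | x y x' y' where "(x, y, x', y') \<in> hlinks"
      "(u, v, u', v') = ([x, y], [x + a, flip y], [x', y'], [x' + a, flip y'])"
    by (auto simp: switches_def)
  then show ?thesis
  proof cases
    case 1
    note v = vlinks_valid[OF 1(1)]
    have F: "(u, v) \<in> factor" "(u', v') \<in> factor"
      using 1 v by (auto simp: factor_def factor_arcs_def)
    have "\<bar>int (flip x) - int (flip x')\<bar> = int a"
    proof (cases "x \<le> x'")
      case True
      then have "x' = x + a" using v(3) by linarith
      then show ?thesis using even_a by (simp add: flip_add)
    next
      case False
      then have "x = x' + a" using v(3) by linarith
      then show ?thesis using even_a by (simp add: flip_add)
    qed
    then have "knight_adj a 1 2 u u'" "knight_adj a 1 2 v v'"
      using 1 v a_pos by (auto intro!: knight_adj_2)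
    then show ?thesis using adj F by blast
  next
    case 2
    note h = hlinks_valid[OF 2(1)]
    have F: "(u, v) \<in> factor" "(u', v') \<in> factor"
      using 2 h by (auto simp: factor_def factor_arcs_def)
    have "x' = x + 1" "y' = y + a" using 2 by (auto simp: hlinks_def)
    then have "knight_adj a 1 2 u u'" "knight_adj a 1 2 v v'"
      using 2 a_pos even_a by (auto intro!: knight_adj_2 simp: flip_add)
    then show ?thesis using adj F by blast
  qed
qed

lemma switches_disjoint:
  assumes "s \<in> switches" "s' \<in> switches" "s \<noteq> s'"
  shows "switch_edges s \<inter> switch_edges s' = {}"
proof -
  have vv: "switch_edges (vswitch q) \<inter> switch_edges (vswitch r) = {}"
    if "q \<in> vlinks" "r \<in> vlinks" "q \<noteq> r" for q r
  proof (rule ccontr)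
    obtain x y x' y' where q: "q = (x, y, x', y')" by (cases q)
    obtain u v u' v' where r: "r = (u, v, u', v')" by (cases r)
    assume "switch_edges (vswitch q) \<inter> switch_edges (vswitch r) \<noteq> {}"
    then have "{(x, y), (x', y')} \<inter> {(u, v), (u', v')} \<noteq> {}"
      using edge_vert_meet[of x y u v] edge_vert_meet[of x y u' v']
        edge_vert_meet[of x' y' u v] edge_vert_meet[of x' y' u' v']
      unfolding q r by (simp add: Int_Un_distrib Int_Un_distrib2) blast
    then show False using vlinks_matching[of x y x' y' u v u' v'] that q r by auto
  qed
  have hh: "switch_edges (hswitch q) \<inter> switch_edges (hswitch r) = {}"
    if "q \<in> hlinks" "r \<in> hlinks" "q \<noteq> r" for q r
  proof (rule ccontr)
    obtain x y x' y' where q: "q = (x, y, x', y')" by (cases q)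
    obtain u v u' v' where r: "r = (u, v, u', v')" by (cases r)
    assume "switch_edges (hswitch q) \<inter> switch_edges (hswitch r) \<noteq> {}"
    then have "{(x, y), (x', y')} \<inter> {(u, v), (u', v')} \<noteq> {}"
      using edge_horiz_meet[of x y u v] edge_horiz_meet[of x y u' v']
        edge_horiz_meet[of x' y' u v] edge_horiz_meet[of x' y' u' v']
      unfolding q r by (simp add: Int_Un_distrib Int_Un_distrib2) blast
    \<comment> \<open>First ends lie in rows below 2 and second ends in rows from \<open>a\<close>
      on, so a first end is never a second end.\<close>
    then show False using that a_ge2 unfolding q r hlinks_def by auto
  qed
  have vh: "switch_edges (vswitch q) \<inter> switch_edges (hswitch r) = {}" for q r
    using edge_vert_horiz_meet by (cases q; cases r) (simp add: Int_Un_distrib Int_Un_distrib2)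
  from assms(1) consider q where "q \<in> vlinks" "s = vswitch q" | q where "q \<in> hlinks" "s = hswitch q"
    by (auto simp: switches_def)
  moreover from assms(2) consider r where "r \<in> vlinks" "s' = vswitch r"
    | r where "r \<in> hlinks" "s' = hswitch r"
    by (auto simp: switches_def)
  ultimately show ?thesis
    using vv hh vh assms(3) by (metis inf_commute)
qed

lemma finite_switches: "finite switches"
proof (rule finite_subset)
  let ?V = "grid n 2"
  show "switches \<subseteq> ?V \<times> ?V \<times> ?V \<times> ?V"
    using switches_valid two_regular_factor by (fastforce simp: two_regular_def)
  show "finite (?V \<times> ?V \<times> ?V \<times> ?V)" by (simp add: finite_grid)
qed

end

section \<open>Reachability after the switches, abstracted to an equivalence
  \<open>R\<close>\<close>

locale knight_board_linked = knight_board +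
  fixes R :: "nat list rel"
  assumes refl_R: "refl R" and sym_R: "sym R" and trans_R: "trans R"
    and factor_R: "factor \<subseteq> R"
    and link_R: "(x, y, x', y') \<in> vlinks \<union> hlinks \<Longrightarrow> ([x, y], [x', y']) \<in> R"
begin

text \<open>The edges of the factor and the links in \<open>vlinks\<close> preserve \<open>cls\<close> and connect each of its fibres. The
  links in \<open>hlinks\<close> increment the first component, and the one from column \<open>a - 1\<close> to column \<open>a\<close> leads
  back to its value 0 with the parity reversed.\<close>

definition cls :: "nat \<Rightarrow> nat \<Rightarrow> nat \<times> bool" where
  "cls x y = (x mod a div 2, even (x div a + y))"

lemma cls_flip [simp]: "cls (flip x) y = cls x y"
  by (simp add: cls_def flip_div_mod even_a a_pos flip_div2)

lemma cls_shift_y [simp]: "cls x (y + a) = cls x y"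
  using even_a by (simp add: cls_def)

lemma cls_right: "\<bar>int y - int y'\<bar> = 1 \<Longrightarrow> cls (x + a) y' = cls x y"
  using abs_diff_one_parity[of y y'] a_pos by (auto simp: cls_def)

text \<open>Carries the invariant \<open>cls\<close> along each connection, so that the class is
  still known once a vertex has been moved into the last strip.\<close>

definition sim :: "nat \<Rightarrow> nat \<Rightarrow> nat \<Rightarrow> nat \<Rightarrow> bool" where
  "sim x y x' y' \<longleftrightarrow> ([x, y], [x', y']) \<in> R \<and> cls x y = cls x' y'"

lemma sim_refl: "sim x y x y"
  using refl_R by (auto simp: sim_def refl_on_def)

lemma sim_sym: "sim x y x' y' \<Longrightarrow> sim x' y' x y"
  using sym_R by (auto simp: sim_def dest: symD)

lemma sim_trans [trans]: "sim x y x' y' \<Longrightarrow> sim x' y' x'' y'' \<Longrightarrow> sim x y x'' y''"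
  using trans_R by (auto simp: sim_def dest: transD)

lemma sim_vert: "vert x y \<Longrightarrow> sim x y (flip x) (y + a)"
  using factor_R by (auto simp: sim_def factor_def factor_arcs_def)

lemma sim_vert_down:
  assumes "a \<le> y" "vert x (y - a)"
  shows "sim x y (flip x) (y - a)"
  using sim_sym[OF sim_vert[of "flip x" "y - a"]] assms by simp

lemma sim_horiz:
  assumes "horiz x y y'"
  shows "sim x y (x + a) y'"
proof -
  have "([x, y], [x + a, y']) \<in> R" using assms factor_R by (auto simp: factor_def factor_arcs_def)
  moreover have "\<bar>int y - int y'\<bar> = 1"
    using assms abs_diff_flip[of y] by (auto simp: horiz_def split: if_splits)
  ultimately show ?thesis using cls_right[of y y' x] by (simp add: sim_def)
qed

lemma sim_vlink:
  assumes "(x, y, x', y') \<in> vlinks"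
  shows "sim x y x' y'"
proof -
  have R: "([x, y], [x', y']) \<in> R" using link_R assms by blast
  note v = vlinks_valid(3,4)[OF assms]
  have "cls x y = cls x' y'"
  proof (cases "x \<le> x'")
    case True
    then have "x' = x + a" using v(1) by linarith
    then show ?thesis using cls_right[OF v(2)] by simp
  next
    case False
    then have x: "x = x' + a" using v(1) by linarith
    have "\<bar>int y' - int y\<bar> = 1" using v(2) by linarith
    then show ?thesis using cls_right[of y' y x'] x by simp
  qed
  with R show ?thesis by (simp add: sim_def)
qed

text \<open>In a strip of two columns the vertical edges run through all rows, alternating between
  \<open>x\<close> and \<open>flip x\<close>.\<close>

lemma descend:
  assumes "x < n" "3 \<le> col x" "y < n"
  shows "\<exists>x0\<in>{x, flip x}. \<exists>y0 < a. sim x y x0 y0"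
  using assms
proof (induction y arbitrary: x rule: less_induct)
  case (less y)
  show ?case
  proof (cases "y < a")
    case True
    then show ?thesis using sim_refl by blast
  next
    case False
    then have y: "a \<le> y" "y - a < y" "y - a < n" using a_pos less.prems by auto
    have "vert x (y - a)" using less.prems y by (auto simp: vert_def)
    then have s: "sim x y (flip x) (y - a)" using y(1) by (intro sim_vert_down)
    obtain x0 y0 where x0: "x0 \<in> {flip x, flip (flip x)}" "y0 < a" "sim (flip x) (y - a) x0 y0"
      using less.IH[OF y(2), of "flip x"] less.prems y(3) by auto
    then show ?thesis using sim_trans[OF s] by auto
  qed
qed

text \<open>Where no horizontal edge or link leads to the right, vertical edges first lead to a row
  that has one: a single edge in the strips of three columns, \<open>descend\<close> in the strips
  of two. The possible loss of 1 in the column is less than the gain of \<open>a\<close>.\<close>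

lemma advance:
  assumes x: "x < n" and y: "y < n" and nl: "x + a < n"
  shows "\<exists>x' y'. x < x' \<and> x' < n \<and> y' < n \<and> sim x y x' y'"
proof -
  have hop: ?thesis if "sim x y x0 y0" "x0 \<in> {x, flip x}" "horiz x0 y0 y1" for x0 y0 y1
  proof -
    have "sim x y (x0 + a) y1" using sim_trans[OF that(1) sim_horiz[OF that(3)]] .
    moreover have "x < x0 + a" using that(2) flip_bounds[of x] a_ge2 by auto
    moreover have "x0 + a < n" using that(2) nl by auto
    ultimately show ?thesis using that(3) by (auto simp: horiz_def)
  qed
  have jump: ?thesis if "sim x y x0 y0" "x0 \<in> {x, flip x}" "(x0, y0, x0 + a, flip y0) \<in> vlinks" for x0 y0
  proof -
    have "sim x y (x0 + a) (flip y0)" using sim_trans[OF that(1) sim_vlink[OF that(3)]] .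
    moreover have "x < x0 + a" using that(2) flip_bounds[of x] a_ge2 by auto
    moreover have "x0 + a < n" using that(2) nl by auto
    moreover have "flip y0 < n" using vlinks_valid(2)[OF that(3)] by (simp add: vert_def)
    ultimately show ?thesis by blast
  qed
  have ly: "loc y < height y" by (rule loc_less)
  have fx: "flip x < n" using x by simp
  have down: "sim x y (flip x) (y - a)" "loc (y - a) = loc y - a" "wide (y - a) = wide y" "y - a < n"
    if "a \<le> loc y" "col x = 0 \<or> col x = 2"
    using sim_vert_down[of y x] vert_sides(2)[OF x y that(2)] that(1) loc_diff[OF that(1)] y by auto
  consider "col x = 0" | "col x = 1" | "col x = 2" | "col x = 3" | "col x = 4"
    using col_right(7)[OF x] by linarith
  then show ?thesis
  proof cases
    case 1
    show ?thesis
    proof (cases "{y'. horiz x y y'} = {}")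
      case True
      then have w: "wide y" "a \<le> loc y" "loc y < a + 2"
        using horiz_from(1)[OF x y 1] by (auto split: if_splits)
      then have "loc y - a < a" using a_ge2 by linarith
      then have "horiz (flip x) (y - a) (y - a + 1)"
        using horiz_from(1)[of "flip x" "y - a"] down w 1 fx a_ge2 by auto
      then show ?thesis using hop[of "flip x" "y - a"] down w 1 by blast
    next
      case False
      then show ?thesis using hop[of x y] sim_refl by blast
    qed
  next
    case 2
    show ?thesis
    proof (cases "{y'. horiz x y y'} = {}")
      case True
      \<comment> \<open>The two vertical edges of the middle column lead from these rows to the rows
        \<open>0\<close> and \<open>2 * a + 1\<close> of the block, which do have a step to the
        right.\<close>
      then have w: "wide y" "loc y = a \<or> loc y = a + 1"
        using horiz_from(2)[OF x y 2] by (auto split: if_splits)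
      from w(2) show ?thesis
      proof
        assume l: "loc y = a"
        have s: "sim x y (flip x) (y - a)"
          using vert_middle(2)[OF x y 2] w l by (intro sim_vert_down) auto
        have "loc (y - a) = 0" "y - a < n" using loc_diff(1)[of a y] l y by simp_all
        then have "horiz (flip x) (y - a) (flip (y - a))"
          using horiz_from(2)[of "flip x" "y - a"] 2 fx a_ge2 by auto
        then show ?thesis using hop[of "flip x" "y - a"] s by blast
      next
        assume l: "loc y = a + 1"
        have s: "sim x y (flip x) (y + a)"
          using vert_middle(1)[OF x y 2] w l by (intro sim_vert) auto
        have "y + a < n" "loc (y + a) = 2 * a + 1"
          using loc_add[OF y, of a] l w by (auto simp: height_def)
        then have "horiz (flip x) (y + a) (flip (y + a))"
          using horiz_from(2)[of "flip x" "y + a"] 2 fx a_ge2 by auto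
        then show ?thesis using hop[of "flip x" "y + a"] s by blast
      qed
    next
      case False
      then show ?thesis using hop[of x y] sim_refl by blast
    qed
  next
    case 3
    show ?thesis
    proof (cases "loc y + a < height y")
      case True
      then have "(x, y, x + a, flip y) \<in> vlinks" using 3 y nl by (simp add: vlinks_def)
      then show ?thesis using jump[of x y] sim_refl by blast
    next
      case False
      then have l: "a \<le> loc y" unfolding height_def by (cases "wide y") auto
      note d = down[OF l disjI2[OF 3]]
      have "loc (y - a) + a < height (y - a)" using d l ly by (simp add: height_def)
      then have "(flip x, y - a, flip x + a, flip (y - a)) \<in> vlinks"
        using 3 nl d by (simp add: vlinks_def)
      then show ?thesis using jump[of "flip x" "y - a"] d by blast
    qed
  next
    case 4
    then obtain x0 y0 where x0: "x0 \<in> {x, flip x}" "y0 < a" "sim x y x0 y0"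
      using descend[OF x _ y] by auto
    have "x0 < n" "col x0 = 3" "y0 < n" using x0 4 x n_ge by auto
    then have "horiz x0 y0 (flip y0)" using x0(2) by (auto simp: horiz_def)
    then show ?thesis using hop[of x0 y0] x0 by blast
  next
    case 5
    then obtain x0 y0 where x0: "x0 \<in> {x, flip x}" "y0 < a" "sim x y x0 y0"
      using descend[OF x _ y] by auto
    have "(x0, y0, x0 + a, flip y0) \<in> vlinks" using x0 5 nl n_ge by (auto simp: vlinks_def)
    then show ?thesis using jump[of x0 y0] x0 by blast
  qed
qed

lemma reach_last:
  assumes "x < n" "y < n"
  shows "\<exists>z y'. z < n \<and> n \<le> z + a \<and> y' < n \<and> sim x y z y'"
  using assms
proof (induction "n - x" arbitrary: x y rule: less_induct)
  case less
  show ?case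
  proof (cases "x + a < n")
    case True
    obtain x' y' where x': "x < x'" "x' < n" "y' < n" "sim x y x' y'"
      using advance[OF less.prems True] by blast
    then have "n - x' < n - x" by auto
    from less.hyps[OF this x'(2,3)] show ?thesis using sim_trans[OF x'(4)] by blast
  next
    case False
    then show ?thesis using less.prems sim_refl by (intro exI[of _ x] exI[of _ y]) auto
  qed
qed

section \<open>The last strip\<close>

lemma last_flip:
  assumes "z < n" "n \<le> z + a"
  shows "flip z < n" "n \<le> flip z + a"
  using assms flip_add_less_n[of z] by (simp, linarith)

lemma vert_last:
  assumes "z < n" "n \<le> z + a" "y + a < n"
  shows "vert z y" "vert (z - a) y"
  using assms col_last[OF assms(1,2)] by (auto simp: vert_def)

lemma last_descend:
  assumes "z < n" "n \<le> z + a" "a \<le> y" "y < n"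
  shows "sim z y (flip z) (y - a)" "sim (z - a) y (flip z - a) (y - a)"
  using sim_vert_down[OF assms(3), of z] sim_vert_down[OF assms(3), of "z - a"]
    vert_last[OF assms(1,2), of "y - a"] assms col_last(2)[OF assms(1,2)] even_a
  by (auto simp: flip_diff)

text \<open>Vertical edges are complete in both columns, so a step in row \<open>y\<close> is
  imitated by one in row \<open>y - a\<close>; rows below \<open>a\<close> have a horizontal edge of
  the factor.\<close>

lemma last_horiz:
  assumes "z < n" "n \<le> z + a" "y < n"
  shows "sim (z - a) y z (flip y)"
  using assms
proof (induction y arbitrary: z rule: less_induct)
  case (less y)
  note c = col_last[OF less.prems(1,2)]
  show ?case
  proof (cases "y < a")
    case True
    then have "horiz (z - a) y (flip y)" using c less.prems by (auto simp: horiz_def)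
    from sim_horiz[OF this] show ?thesis using c by simp
  next
    case False
    then have y: "a \<le> y" "y - a < y" "y - a < n" using a_pos less.prems by auto
    have fy: "a \<le> flip y" "flip y < n"
      using y less.prems flip_less_iff[OF even_a, of y] by (auto simp: not_less[symmetric])
    have "sim (z - a) y (flip z - a) (y - a)" using last_descend(2) less.prems y by simp
    also have "sim (flip z - a) (y - a) (flip z) (flip (y - a))"
      using less.IH[OF y(2) _ _ y(3), of "flip z"] last_flip[OF less.prems(1,2)] by simp
    also have "flip (y - a) = flip y - a" using y even_a by (simp add: flip_diff)
    also have "sim (flip z) (flip y - a) z (flip y)"
      using sim_sym[OF last_descend(1)[OF less.prems(1,2) fy]] .
    finally show ?thesis .
  qed
qed

text \<open>The links across the pairs of rows lie between rows \<open>a\<close> and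
  \<open>2 * a\<close>. A row below \<open>a\<close> is lifted to them by one vertical edge, and a
  higher row is first lowered by multiples of \<open>a\<close>.\<close>

lemma last_cross:
  assumes "z < n" "n \<le> z + a" "odd y" "y + 1 < n"
  shows "sim (z - a) y z (y + 1) \<and> sim z y (z - a) (y + 1)"
  using assms
proof (induction y arbitrary: z rule: less_induct)
  case (less y)
  note fl = last_flip[OF less.prems(1,2)]
  note c = col_last[OF less.prems(1,2)] col_last[OF fl]
  have fz: "flip z - a = flip (z - a)" using c even_a by (simp add: flip_diff)
  show ?case
  proof (cases "y < a")
    case True
    then have y: "odd (y + a)" "a < y + a" "y + a < 2 * a" "y + a + 1 < n"
      using less.prems even_a n_ge odd_pos[of y] by auto
    then have "(flip z - a, y + a, flip z, y + a + 1) \<in> vlinks" "(flip z, y + a, flip z - a, y + a + 1) \<in> vlinks"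
      using c fl by (auto simp: vlinks_def)
    from this[THEN sim_vlink]
    have "sim (flip z - a) (y + a) (flip z) (y + 1 + a)" "sim (flip z) (y + a) (flip z - a) (y + 1 + a)"
      by simp_all
    moreover have "sim z y (flip z) (y + a)" "sim z (y + 1) (flip z) (y + 1 + a)"
        "sim (z - a) y (flip z - a) (y + a)" "sim (z - a) (y + 1) (flip z - a) (y + 1 + a)"
      using vert_last[OF less.prems(1,2), of y] vert_last[OF less.prems(1,2), of "y + 1"] y(4)
        sim_vert[of z y] sim_vert[of z "y + 1"] sim_vert[of "z - a" y] sim_vert[of "z - a" "y + 1"]
      unfolding fz by simp_all
    ultimately show ?thesis by (meson sim_sym sim_trans)
  next
    case False
    then have y: "a \<le> y" "y - a < y" "odd (y - a)" "y - a + 1 < n" "y < n" "a \<le> y + 1" "y + 1 - a = y - a + 1"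
      using a_pos less.prems even_a by auto
    have "sim (flip z - a) (y - a) (flip z) (y - a + 1)" "sim (flip z) (y - a) (flip z - a) (y - a + 1)"
      using less.IH[OF y(2) fl y(3,4)] by auto
    moreover have "sim z y (flip z) (y - a)" "sim (z - a) y (flip z - a) (y - a)"
        "sim z (y + 1) (flip z) (y - a + 1)" "sim (z - a) (y + 1) (flip z - a) (y - a + 1)"
      using last_descend[OF less.prems(1,2) y(1,5)] last_descend[OF less.prems(1,2) y(6) less.prems(4)] y(7)
      by simp_all
    ultimately show ?thesis by (meson sim_sym sim_trans)
  qed
qed

text \<open>One step inside a pair of rows and one across the pairs, in the order given by the
  parity of \<open>y\<close>, return to the column two rows higher.\<close>

lemma last_step2:
  assumes z: "z < n" "n \<le> z + a" and y: "y + 2 < n"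
  shows "sim z y z (y + 2)"
proof (cases "even y")
  case True
  have "sim z y (z - a) (y + 1)"
    using sim_sym[OF last_horiz[OF z, of "y + 1"]] True y by (simp add: flip_def)
  also have "sim (z - a) (y + 1) z (y + 2)" using last_cross[OF z, of "y + 1"] True y by simp
  finally show ?thesis .
next
  case False
  have "sim z y (z - a) (y + 1)" using last_cross[OF z False] y by simp
  also have "sim (z - a) (y + 1) z (y + 2)"
    using last_horiz[OF z, of "y + 1"] False y by (simp add: flip_def)
  finally show ?thesis .
qed

lemma last_parity:
  assumes z: "z < n" "n \<le> z + a" and "y < n"
  shows "sim z y z (y mod 2)"
  using assms(3)
proof (induction y rule: less_induct)
  case (less y)
  show ?case
  proof (cases "y < 2")
    case True
    then show ?thesis using sim_refl by simp
  next
    case False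
    then have y: "y - 2 < y" "y - 2 < n" "y = y - 2 + 2" using less.prems by auto
    have "sim z y z (y - 2)" using sim_sym[OF last_step2[OF z, of "y - 2"]] y less.prems by simp
    also have "sim z (y - 2) z ((y - 2) mod 2)" using less.IH y by blast
    also have "(y - 2) mod 2 = y mod 2" using False by presburger
    finally show ?thesis .
  qed
qed

text \<open>Equal classes force \<open>z\<close> to be \<open>z'\<close> or its partner and the rows
  to have equal parity. A vertical edge, which keeps the parity as \<open>a\<close> is even, passes
  between the partners.\<close>

lemma last_same_cls:
  assumes z: "z < n" "n \<le> z + a" "y < n" and z': "z' < n" "n \<le> z' + a" "y' < n"
    and eq: "cls z y = cls z' y'"
  shows "sim z y z' y'"
proof -
  have d: "u div a = last_index u" if "u < n" "n \<le> u + a" for u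
    using that less_n_iff[of u] add_less_n_iff[of u] by simp
  have "z mod a div 2 = z' mod a div 2" using eq by (simp add: cls_def)
  then have "z mod a = z' mod a \<or> z mod a = flip (z' mod a)"
    by (rule eq_or_flip_if_div2_eq)
  then have m: "z mod a = z' mod a \<or> z mod a = flip z' mod a" by (simp add: flip_div_mod even_a a_pos)
  have zz: "z = z' \<or> z = flip z'"
  proof -
    have "last_index z = last_index z' \<or> last_index z = last_index (flip z')"
      using m by (auto simp: last_index_def)
    then have "z div a = z' div a" using d z z' by auto
    moreover have "flip z' div a = z' div a" by (simp add: flip_div_mod even_a a_pos)
    ultimately show ?thesis using m by (metis div_mult_mod_eq)
  qed
  then have "z div a = z' div a" using flip_div_mod(1)[OF even_a a_pos, of z'] by auto
  then have par: "y mod 2 = y' mod 2" using eq by (auto simp: cls_def mod2_eq_if)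
  have e: "y' mod 2 + a < n" using n_ge a_ge2 by linarith
  have "sim (flip z') (y' mod 2) z' (y' mod 2)"
  proof -
    have "sim (flip z') (y' mod 2) z' (y' mod 2 + a)"
      using sim_vert[OF vert_last(1)[OF last_flip[OF z'(1,2)] e]] by simp
    also have "sim z' (y' mod 2 + a) z' ((y' mod 2 + a) mod 2)"
      using last_parity[OF z'(1,2) e] .
    also have "(y' mod 2 + a) mod 2 = y' mod 2" using even_a by presburger
    finally show ?thesis .
  qed
  then have "sim z (y mod 2) z' (y' mod 2)" using zz par sim_refl by auto
  then show ?thesis
    using last_parity[OF z] last_parity[OF z'] by (meson sim_sym sim_trans)
qed

lemma same_cls:
  assumes "x < n" "y < n" "x' < n" "y' < n" "cls x y = cls x' y'"
  shows "sim x y x' y'"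
proof -
  obtain z w where z: "z < n" "n \<le> z + a" "w < n" "sim x y z w" using reach_last[OF assms(1,2)] by blast
  obtain z' w' where z': "z' < n" "n \<le> z' + a" "w' < n" "sim x' y' z' w'"
    using reach_last[OF assms(3,4)] by blast
  have "cls z w = cls z' w'" using z z' assms(5) by (simp add: sim_def)
  then have "sim z w z' w'" using last_same_cls z z' by blast
  then show ?thesis using z(4) z'(4) by (meson sim_sym sim_trans)
qed

section \<open>Joining the classes\<close>

abbreviation con :: "nat \<Rightarrow> nat \<Rightarrow> nat \<Rightarrow> nat \<Rightarrow> bool" where
  "con x y x' y' \<equiv> ([x, y], [x', y']) \<in> R"

lemma con_trans [trans]: "con x y x' y' \<Longrightarrow> con x' y' x'' y'' \<Longrightarrow> con x y x'' y''"
  using trans_R by (auto dest: transD)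

lemma con_sym: "con x y x' y' \<Longrightarrow> con x' y' x y"
  using sym_R by (auto dest: symD)

lemma small_less_n: "x \<le> 2 * a \<Longrightarrow> x < n"
  using n_ge a_pos by linarith

lemma con_bottom:
  assumes "2 * q < a" "e < 2"
  shows "con 0 e (2 * q) e"
  using assms(1)
proof (induction q)
  case 0
  then show ?case using refl_R by (auto simp: refl_on_def)
next
  case (Suc q)
  have e: "e < n" "e + a < n" using assms(2) a_ge2 n_ge by auto
  have "con 0 e (2 * q) e" using Suc by simp
  also have "con (2 * q) e (2 * q + 1) e"
    using same_cls[of "2 * q" e "2 * q + 1" e] Suc.prems e small_less_n
    by (simp add: cls_def sim_def)
  also have "con (2 * q + 1) e (2 * q + 2) (e + a)"
    using link_R[of "2 * q + 1" e "2 * q + 2" "e + a"] Suc.prems assms(2) by (auto simp: hlinks_def)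
  also have "con (2 * q + 2) (e + a) (2 * Suc q) e"
    using same_cls[of "2 * q + 2" "e + a" "2 * q + 2" e] Suc.prems e small_less_n[of "2 * q + 2"]
    by (simp add: sim_def)
  finally show ?case .
qed

text \<open>The route runs through all pairs of residues and on to column \<open>a\<close>, whose
  residue is 0 again but whose quotient is 1, so that the parity in \<open>cls\<close> has
  changed.\<close>

lemma con_corner: "con 0 0 0 1"
proof -
  define q where "q = a div 2 - 1"
  have q: "2 * q + 2 = a" using even_a a_ge2 unfolding q_def by presburger
  have e: "0 < n" "a < n" "1 < n" "2 * q + 1 < n" "2 * q < n" using q n_ge a_ge2 by auto
  have "con 0 0 (2 * q) 0" using con_bottom[of q 0] q by simp
  also have "con (2 * q) 0 (2 * q + 1) 0"
    using same_cls[of "2 * q" 0 "2 * q + 1" 0] q e by (simp add: cls_def sim_def)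
  also have "con (2 * q + 1) 0 a a"
    using link_R[of "2 * q + 1" 0 a a] q by (auto simp: hlinks_def)
  also have "con a a 0 1"
    using same_cls[of a a 0 1] e even_a a_pos by (simp add: cls_def sim_def)
  finally show ?thesis .
qed

lemma con_origin:
  assumes "x < n" "y < n"
  shows "con 0 0 x y"
proof -
  \<comment> \<open>\<open>(2 * q, e)\<close> represents the class of \<open>(x, y)\<close> in the
    two bottom rows.\<close>
  define q e where "q = x mod a div 2" and "e = (x div a + y) mod 2"
  have q: "2 * q \<le> x mod a" "x mod a < a" using a_pos by (auto simp: q_def)
  then have q': "2 * q < a" by linarith
  have e: "e < 2" "e < n" using n_ge a_pos by (auto simp: e_def)
  have "con 0 0 0 e" using con_corner refl_R e(1) by (cases "e = 0") (auto simp: refl_on_def less_2_cases_iff)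
  also have "con 0 e (2 * q) e" using con_bottom q' e by simp
  also have "con (2 * q) e x y"
  proof -
    have "even e \<longleftrightarrow> even (x div a + y)" by (simp add: e_def)
    then have "cls (2 * q) e = cls x y" using q' by (simp add: cls_def q_def)
    moreover have "2 * q < n" using q' small_less_n by simp
    ultimately show ?thesis using same_cls[of "2 * q" e x y] assms e by (simp add: sim_def)
  qed
  finally show ?thesis .
qed

lemma grid_connected: "grid n 2 \<times> grid n 2 \<subseteq> R"
proof (rule subrelI)
  fix u v assume "(u, v) \<in> grid n 2 \<times> grid n 2"
  then have uv: "u \<in> grid n 2" "v \<in> grid n 2" by auto
  obtain x y where "u = [x, y]" "x < n" "y < n" using uv(1) by (rule grid_2_cases)
  moreover obtain x' y' where "v = [x', y']" "x' < n" "y' < n" using uv(2) by (rule grid_2_cases)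
  ultimately show "(u, v) \<in> R" using con_trans[OF con_sym[OF con_origin] con_origin] by simp
qed

end

section \<open>The tour of the square board\<close>

context knight_board begin

lemma stackable_tour_2: "stackable_tour a n 2"
proof -
  let ?V = "grid n 2" and ?E = "parcs (knight_graph a 1 n 2)"
  obtain F where F: "two_regular ?V F" "F \<subseteq> ?E" "factor \<subseteq> F\<^sup>*"
      "factor - \<Union>(switch_edges ` switches) \<subseteq> F" "\<forall>(u, v, u', v')\<in>switches. (u, u') \<in> F\<^sup>*"
    using switching[OF finite_switches two_regular_factor factor_subset sym_parcs_knight_graph
        switches_valid switches_disjoint] by blast
  interpret knight_board_linked a n k t "F\<^sup>*"
  proof
    show "refl (F\<^sup>*)" "trans (F\<^sup>*)" by (rule refl_rtrancl, rule trans_rtrancl)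
    show "sym (F\<^sup>*)" using F(1) by (auto simp: two_regular_def intro: sym_rtrancl)
    show "factor \<subseteq> F\<^sup>*" by fact
    fix x y x' y' assume "(x, y, x', y') \<in> vlinks \<union> hlinks"
    then have "vswitch (x, y, x', y') \<in> switches \<or> hswitch (x, y, x', y') \<in> switches"
      unfolding switches_def by blast
    then show "([x, y], [x', y']) \<in> F\<^sup>*" using F(5) by auto
  qed
  \<comment> \<open>A last column: the links meeting it have their lower ends in rows up to
    \<open>2 * a\<close>, so vertical edges starting higher survive all switches.\<close>
  define z where "z = n - 2"
  have z: "z < n" "n \<le> z + a" using n_ge a_ge2 by (auto simp: z_def)
  have kept: "([z, y], [flip z, y + a]) \<in> F" if y: "2 * a < y" "y + a < n" for y
  proof -
    have "([z, y], [flip z, y + a]) \<in> factor"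
      using vert_last(1)[OF z y(2)] by (auto simp: factor_def factor_arcs_def)
    moreover have "([z, y], [flip z, y + a]) \<notin> switch_edges s" if "s \<in> switches" for s
    proof
      assume m: "([z, y], [flip z, y + a]) \<in> switch_edges s"
      have e: "([z, y], [flip z, y + a]) \<in> edge [z, y] [flip z, y + a]" by (simp add: edge_def)
      from that consider (1) x1 y1 x2 y2 where "(x1, y1, x2, y2) \<in> vlinks" "s = vswitch (x1, y1, x2, y2)"
        | (2) x1 y1 x2 y2 where "s = hswitch (x1, y1, x2, y2)"
        by (auto simp: switches_def)
      then show False
      proof cases
        case 1
        then have "x1 = z \<and> y1 = y \<or> x2 = z \<and> y2 = y"
          using m e edge_vert_meet[of z y x1 y1] edge_vert_meet[of z y x2 y2] by auto
        with 1(1) z y show False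
          using col_last[OF z] by (cases rule: vlinks_cases) auto
      next
        case 2
        then show False using m e edge_vert_horiz_meet by fastforce
      qed
    qed
    ultimately show ?thesis using F(4) by blast
  qed
  \<comment> \<open>Consecutive surviving edges are translates of each other by \<open>a\<close>
    along the second axis.\<close>
  have "([z, 3 * a], [flip z, 4 * a]) \<in> F" "([z, 4 * a], [flip z, 5 * a]) \<in> F"
    using kept[of "3 * a"] kept[of "4 * a"] n_ge a_pos by (simp_all add: algebra_simps)
  then have "([z, 3 * a], [flip z, 4 * a]) \<in> F"
    "([z, 3 * a][1 := [z, 3 * a] ! 1 + a], [flip z, 4 * a][1 := [flip z, 4 * a] ! 1 + a]) \<in> F"
    by (simp_all add: algebra_simps)
  moreover have "connected_two_factor ?V F"
    using F(1) grid_connected by (simp add: connected_two_factor_def)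
  ultimately show ?thesis
    unfolding stackable_tour_def using F(2) one_less_numeral_iff semiring_norm(76) by blast
qed

end

section \<open>Choice of the blocks and induction on the dimension\<close>

theorem theorem3:
  fixes a n d :: nat
  assumes "even a" and "a > 0"
    and "even n" and "n > 0"
    and "n \<ge> a * (6 * a + 2)"
    and "d \<ge> 2"
  shows "\<exists>p. pre_digraph.hamiltonian_cycle (with_proj (knight_graph a 1 n d)) p"
proof -
  have a2: "2 \<le> a" using assms(1,2) by presburger
  have "a * 14 \<le> a * (6 * a + 2)" using a2 by (intro mult_left_mono) auto
  then have n10: "10 * a \<le> n" using assms(5) by linarith
  \<comment> \<open>Each wide block absorbs two extra rows:
    \<open>2 * a * s + 2 * t = 2 * a * (s - t) + (2 * a + 2) * t\<close>, so \<open>k\<close> is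
    \<open>s - t\<close>.\<close>
  define t where "t = n div 2 mod a"
  have t: "t < a" using assms(2) by (simp add: t_def)
  obtain k where k: "n = 2 * a * k + (2 * a + 2) * t" "0 < k"
  proof -
    define s where "s = n div 2 div a"
    have "n div 2 = s * a + t" by (simp add: s_def t_def)
    then have n: "n = 2 * a * s + 2 * t" using assms(3) by (auto elim!: evenE simp: algebra_simps)
    \<comment> \<open>Here the quadratic bound on \<open>n\<close> enters:
      \<open>s \<le> t < a\<close> would make \<open>n\<close> smaller than
      \<open>2 * a * a + 2 * a\<close>.\<close>
    have "t < s"
    proof (rule ccontr)
      assume "\<not> t < s"
      then have "2 * a * s \<le> 2 * a * a" using t by (intro mult_left_mono) auto
      then have "n < 2 * a * a + 2 * a" using n t by linarith
      moreover have "2 * a * a + 2 * a \<le> a * (6 * a + 2)" by (simp add: algebra_simps)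
      ultimately show False using assms(5) by linarith
    qed
    then obtain k where "s = t + k" "0 < k" by (metis less_imp_add_positive)
    with n show thesis by (intro that[of k]) (auto simp: algebra_simps)
  qed
  interpret knight_board a n k t using assms k n10 by unfold_locales auto
  have "stackable_tour a n d"
    using assms(6)
  proof (induction d rule: dec_induct)
    case base
    show ?case by (rule stackable_tour_2)
  next
    case (step d)
    then show ?case using stackable_tour_Suc[of a n d] a_pos n_ge by auto
  qed
  then obtain F where F: "connected_two_factor (grid n d) F" "F \<subseteq> parcs (knight_graph a 1 n d)" "F \<noteq> {}"
    by (auto simp: stackable_tour_def)
  then have "grid n d \<noteq> {}" by (auto simp: knight_graph_def)
  with F(1,2) show ?thesis
    by (intro connected_two_factor_hamiltonian[of _ F]) (auto simp: knight_graph_def)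
qed

end
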